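(* Let $X$ be a complex Banach space, $A\in L(X)$ a bounded linear operator, $\omega>0$, $c\in\mathbb{C}\setminus\{0\}$, and suppose that $c\neq e^{\omega\lambda}$ for all $\lambda\in\sigma(A)$. Let $g\in C(\mathbb{R}\times X,X)$ satisfy (i) $g(t+\omega,cy)=cg(t,y)$ for all $t\in\mathbb{R}$ and $y\in X$; (ii) there is a constant $L>0$ such that $\|g(t,y_1)-g(t,y_2)\|\le L\|y_1-y_2\|$ for all $t\in\mathbb{R}$ and $y_1,y_2\in X$. Let $M=\max_{t\in[0,\omega]}\int_0^\omega\|K(t,s)\|\,ds$. If $LM<1$, then the equation $\dot y=Ay+g(t,y)$ has a unique $(\omega,c)$-periodic solution $y:\mathbb{R}\to X$, and it satisfies $$\|y\|_0\le\frac{M\|g(\cdot,0)\|_0}{1-LM}.$$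
   Context: A function $y:\mathbb{R}\to X$ is $(\omega,c)$-periodic if $y(t+\omega)=cy(t)$ for all $t\in\mathbb{R}$. For a continuous function $h$ with values in $X$ defined on a set containing $[0,\omega]$, $\|h\|_0=\max_{t\in[0,\omega]}\|h(t)\|$. $\sigma(A)$ is the spectrum of $A$ and $I$ is the identity on $X$. The assumption on $c$ means $c\notin\sigma(e^{A\omega})$, so $cI-e^{A\omega}$ is invertible, and the kernel $K$ is defined for $t,s\in[0,\omega]$ by $$K(t,s)=\begin{cases}c\,e^{A(t-s)}(cI-e^{A\omega})^{-1}&\text{for } s\in[0,t],\\ e^{A(\omega+t-s)}(cI-e^{A\omega})^{-1}&\text{for } s\in(t,\omega].\end{cases}$$ *)

theory Defs
  imports "HOL-Analysis.Analysis"
begin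

section \<open>Complex Banach spaces\<close>

class complex_normed_vector = real_normed_vector +
  fixes scaleC :: "complex \<Rightarrow> 'a \<Rightarrow> 'a"  (infixr "*\<^sub>C" 75)
  assumes scaleC_add_right: "a *\<^sub>C (x + y) = a *\<^sub>C x + a *\<^sub>C y"
    and scaleC_add_left: "(a + b) *\<^sub>C x = a *\<^sub>C x + b *\<^sub>C x"
    and scaleC_scaleC: "a *\<^sub>C (b *\<^sub>C x) = (a * b) *\<^sub>C x"
    and scaleC_one: "1 *\<^sub>C x = x"
    and scaleR_scaleC: "r *\<^sub>R x = complex_of_real r *\<^sub>C x"
    and norm_scaleC: "norm (a *\<^sub>C x) = cmod a * norm x"

class complex_banach = complex_normed_vector + banach

instantiation complex :: complex_banach
begin
definition scaleC_complex :: "complex \<Rightarrow> complex \<Rightarrow> complex"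
  where "scaleC_complex a x = a * x"
instance
  by standard (simp_all add: scaleC_complex_def algebra_simps norm_mult scaleR_conv_of_real)
end

lemma bounded_linear_scaleC: "bounded_linear (\<lambda>x::'a::complex_normed_vector. a *\<^sub>C x)"
proof (rule bounded_linear_intro[where K = "cmod a"])
  fix r :: real and x :: 'a
  show "a *\<^sub>C (r *\<^sub>R x) = r *\<^sub>R (a *\<^sub>C x)"
    by (simp add: scaleR_scaleC scaleC_scaleC mult.commute)
qed (simp_all add: scaleC_add_right norm_scaleC mult.commute)

section \<open>Bounded complex-linear operators\<close>

instantiation blinfun :: (real_normed_vector, complex_normed_vector) complex_normed_vector
begin

lift_definition scaleC_blinfun :: "complex \<Rightarrow> 'a \<Rightarrow>\<^sub>L 'b \<Rightarrow> 'a \<Rightarrow>\<^sub>L 'b"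
  is "\<lambda>a f x. a *\<^sub>C f x"
  by (rule bounded_linear_compose[OF bounded_linear_scaleC])

instance
proof
  fix a b :: complex and r :: real and f g :: "'a \<Rightarrow>\<^sub>L 'b"
  show "a *\<^sub>C (f + g) = a *\<^sub>C f + a *\<^sub>C g" by transfer (simp add: scaleC_add_right)
  show "(a + b) *\<^sub>C f = a *\<^sub>C f + b *\<^sub>C f" by transfer (simp add: scaleC_add_left)
  show scaleC: "a *\<^sub>C (b *\<^sub>C f) = (a * b) *\<^sub>C f" for a b and f :: "'a \<Rightarrow>\<^sub>L 'b"
    by transfer (simp add: scaleC_scaleC)
  show one: "1 *\<^sub>C f = f" for f :: "'a \<Rightarrow>\<^sub>L 'b" by transfer (simp add: scaleC_one)
  show "r *\<^sub>R f = complex_of_real r *\<^sub>C f" by transfer (simp add: scaleR_scaleC)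
  have le: "norm (a *\<^sub>C f) \<le> cmod a * norm f" for a and f :: "'a \<Rightarrow>\<^sub>L 'b"
  proof (rule norm_blinfun_bound)
    fix x
    have "norm ((a *\<^sub>C f) x) = cmod a * norm (f x)"
      by (simp add: scaleC_blinfun.rep_eq norm_scaleC)
    also have "\<dots> \<le> cmod a * (norm f * norm x)"
      by (intro mult_left_mono norm_blinfun) simp
    finally show "norm ((a *\<^sub>C f) x) \<le> cmod a * norm f * norm x" by (simp add: mult.assoc)
  qed simp
  show "norm (a *\<^sub>C f) = cmod a * norm f"
  proof (cases "a = 0")
    case True
    then show ?thesis using le[of 0 f] by simp
  next
    case False
    have "norm f = norm (inverse a *\<^sub>C (a *\<^sub>C f))" using False by (simp add: scaleC one)
    also have "\<dots> \<le> inverse (cmod a) * norm (a *\<^sub>C f)"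
      using le[of "inverse a" "a *\<^sub>C f"] by (simp add: norm_inverse)
    finally show ?thesis using le[of a f] False by (simp add: field_simps)
  qed
qed

end

instance blinfun :: (real_normed_vector, complex_banach) complex_banach ..

text \<open>\<open>'a \<Rightarrow>\<^sub>L 'a\<close> consists of the real-linear bounded operators; \<open>L(X)\<close> is its
  closed subalgebra of complex-linear ones, with the same operator norm.\<close>

definition clinear_ops :: "('a::complex_normed_vector \<Rightarrow>\<^sub>L 'a) set"
  where "clinear_ops = {A. \<forall>a x. blinfun_apply A (a *\<^sub>C x) = a *\<^sub>C blinfun_apply A x}"

definition spectrum :: "('a::complex_normed_vector \<Rightarrow>\<^sub>L 'a) \<Rightarrow> complex set"
  where "spectrum A = {z. \<not> (\<exists>B \<in> clinear_ops.
    B o\<^sub>L (z *\<^sub>C id_blinfun - A) = id_blinfun \<and> (z *\<^sub>C id_blinfun - A) o\<^sub>L B = id_blinfun)}"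

definition inverse_op :: "('a::complex_normed_vector \<Rightarrow>\<^sub>L 'a) \<Rightarrow> 'a \<Rightarrow>\<^sub>L 'a"
  where "inverse_op A = (THE B. B o\<^sub>L A = id_blinfun \<and> A o\<^sub>L B = id_blinfun)"

text \<open>The library's \<^const>\<open>exp\<close> needs a type of class \<open>banach\<close> and \<open>real_normed_algebra_1\<close>,
  which \<open>'a \<Rightarrow>\<^sub>L 'a\<close> cannot be made an instance of.\<close>

definition exp_op :: "('a::complex_banach \<Rightarrow>\<^sub>L 'a) \<Rightarrow> 'a \<Rightarrow>\<^sub>L 'a"
  where "exp_op A = (\<Sum>n. (((o\<^sub>L) A) ^^ n) id_blinfun /\<^sub>R fact n)"

section \<open>Periodic solutions\<close>

definition wc_periodic :: "real \<Rightarrow> complex \<Rightarrow> (real \<Rightarrow> 'a::complex_banach) \<Rightarrow> bool"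
  where "wc_periodic \<omega> c y \<longleftrightarrow> (\<forall>t. y (t + \<omega>) = c *\<^sub>C y t)"

definition ode_solution ::
    "('a::complex_banach \<Rightarrow>\<^sub>L 'a) \<Rightarrow> (real \<Rightarrow> 'a \<Rightarrow> 'a) \<Rightarrow> (real \<Rightarrow> 'a) \<Rightarrow> bool"
  where "ode_solution A g y \<longleftrightarrow>
    (\<forall>t. (y has_vector_derivative (blinfun_apply A (y t) + g t (y t))) (at t))"

definition max_on :: "real set \<Rightarrow> (real \<Rightarrow> real) \<Rightarrow> real"
  where "max_on S f = (GREATEST m. m \<in> f ` S)"

lemma max_on_continuous:
  assumes "compact S" "S \<noteq> {}" "continuous_on S f"
  shows "max_on S f \<in> f ` S" and "\<And>t. t \<in> S \<Longrightarrow> f t \<le> max_on S f"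
proof -
  obtain s where s: "s \<in> S" "\<And>t. t \<in> S \<Longrightarrow> f t \<le> f s"
    using continuous_attains_sup[OF assms] by blast
  then have "max_on S f = f s"
    unfolding max_on_def by (intro Greatest_equality) auto
  with s show "max_on S f \<in> f ` S" and "\<And>t. t \<in> S \<Longrightarrow> f t \<le> max_on S f" by auto
qed

definition norm0 :: "real \<Rightarrow> (real \<Rightarrow> 'a::complex_banach) \<Rightarrow> real"
  where "norm0 \<omega> h = max_on {0..\<omega>} (\<lambda>t. norm (h t))"

definition kernel ::
    "('a::complex_banach \<Rightarrow>\<^sub>L 'a) \<Rightarrow> real \<Rightarrow> complex \<Rightarrow> real \<Rightarrow> real \<Rightarrow> 'a \<Rightarrow>\<^sub>L 'a"
  where "kernel A \<omega> c t s =
    (if s \<le> t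
     then c *\<^sub>C (exp_op ((t - s) *\<^sub>R A) o\<^sub>L inverse_op (c *\<^sub>C id_blinfun - exp_op (\<omega> *\<^sub>R A)))
     else exp_op ((\<omega> + t - s) *\<^sub>R A) o\<^sub>L inverse_op (c *\<^sub>C id_blinfun - exp_op (\<omega> *\<^sub>R A)))"

definition kernel_max :: "('a::complex_banach \<Rightarrow>\<^sub>L 'a) \<Rightarrow> real \<Rightarrow> complex \<Rightarrow> real"
  where "kernel_max A \<omega> c =
    max_on {0..\<omega>} (\<lambda>t. integral {0..\<omega>} (\<lambda>s. norm (kernel A \<omega> c t s)))"

end

theory Submission
  imports Defs
begin

text \<open>On one period the equation with the boundary condition \<open>y \<omega> = c *\<^sub>C y 0\<close> is equivalent to
  \<open>y t = \<integral> K(t,s) g(s, y s) ds\<close> over \<open>{0..\<omega>}\<close> (variation of constants), and the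
  right-hand side is a contraction of ratio \<open>L M\<close> in the supremum norm; its fixed point is continued
  to the real line by \<open>(\<omega>,c)\<close>-periodicity.

  That \<open>c I - e\<^bsup>\<omega>A\<^esup>\<close> is invertible is proved without a functional calculus. Put
  \<open>B = \<omega>A - (Ln c) I\<close>, so that no \<open>2\<pi>ik\<close> lies in the spectrum of \<open>B\<close>, and \<open>e\<^bsup>B\<^esup> - I\<close> has to be
  inverted. If \<open>\<parallel>B\<parallel> \<le> 7/2\<close>, then \<open>e\<^bsup>B\<^esup> - I = e\<^bsup>B/2\<^esup> B S\<close> where \<open>S\<close>, the power series of
  \<open>sinh z / z\<close> at \<open>B/2\<close>, is at distance less than 1 from \<open>I\<close>. Otherwise \<open>e\<^bsup>B\<^esup> - I\<close> is the product of
  the \<open>X - \<zeta> I\<close> with \<open>X = e\<^bsup>B/3\<^esup>\<close> and \<open>\<zeta>\<close> a cube root of unity, and up to a scalar these factors are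
  \<open>e\<^bsup>C\<^esup> - I\<close> with \<open>C = (B - 2\<pi>ij I) / 3\<close>, \<open>\<bar>j\<bar> \<le> 1\<close>; the map \<open>r \<mapsto> r/3 + 2\<pi>/3\<close> bounding
  \<open>\<parallel>C\<parallel>\<close> has fixed point \<open>\<pi> < 7/2\<close>, so finitely many steps reach the first case.\<close>

section \<open>The exponential of a bounded operator\<close>

abbreviation opow :: "('a::real_normed_vector \<Rightarrow>\<^sub>L 'a) \<Rightarrow> nat \<Rightarrow> 'a \<Rightarrow>\<^sub>L 'a"
  where "opow A n \<equiv> ((o\<^sub>L) A ^^ n) id_blinfun"

lemma blinfun_compose_id [simp]: "A o\<^sub>L id_blinfun = A" "id_blinfun o\<^sub>L A = A"
  by (auto intro: blinfun_eqI)

lemma blinfun_compose_assoc: "(A o\<^sub>L B) o\<^sub>L C = A o\<^sub>L (B o\<^sub>L C)"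
  by (auto intro: blinfun_eqI)

lemmas compose_bilinear_simps =
  bounded_bilinear.add_left[OF bounded_bilinear_blinfun_compose]
  bounded_bilinear.add_right[OF bounded_bilinear_blinfun_compose]
  bounded_bilinear.diff_left[OF bounded_bilinear_blinfun_compose]
  bounded_bilinear.diff_right[OF bounded_bilinear_blinfun_compose]
  bounded_bilinear.scaleR_left[OF bounded_bilinear_blinfun_compose]
  bounded_bilinear.scaleR_right[OF bounded_bilinear_blinfun_compose]

lemmas bounded_linear_compose_left =
  bounded_bilinear.bounded_linear_left[OF bounded_bilinear_blinfun_compose]

lemmas bounded_linear_compose_right =
  bounded_bilinear.bounded_linear_right[OF bounded_bilinear_blinfun_compose]

lemma norm_opow: "norm (opow A n) \<le> norm A ^ n"
proof (induction n)
  case 0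
  show ?case by (simp add: norm_blinfun_id_le)
next
  case (Suc n)
  have "norm (opow A (Suc n)) \<le> norm A * norm (opow A n)"
    by (simp add: norm_blinfun_compose)
  also have "\<dots> \<le> norm A * norm A ^ n"
    using Suc by (rule mult_left_mono) simp
  finally show ?case by simp
qed

lemma opow_commute: "A o\<^sub>L B = B o\<^sub>L A \<Longrightarrow> opow A n o\<^sub>L B = B o\<^sub>L opow A n"
proof (induction n)
  case (Suc n)
  then show ?case by simp (metis blinfun_compose_assoc)
qed simp

lemma opow_scaleR: "opow (t *\<^sub>R A) n = t ^ n *\<^sub>R opow A n"
  by (induction n) (simp_all add: compose_bilinear_simps)

section \<open>The exponential series and its derivative\<close>

lemma exp_op_sums:
  fixes A :: "'a::complex_banach \<Rightarrow>\<^sub>L 'a"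
  shows "(\<lambda>n. opow A n /\<^sub>R fact n) sums exp_op A"
proof -
  have "summable (\<lambda>n. norm A ^ n /\<^sub>R fact n)"
    by (rule summable_exp_generic)
  then have "summable (\<lambda>n. opow A n /\<^sub>R fact n)"
    by (rule summable_comparison_test') (use norm_opow[where A = A] in \<open>simp add: mult_left_mono\<close>)
  then show ?thesis unfolding exp_op_def by (rule summable_sums)
qed

text \<open>Commuting with \<open>A\<close> passes to each power and, composition being continuous,
  to the limit. This serves the exponential, the Neumann series and, with \<open>B\<close> a scalar
  multiple of the identity, the complex linearity of limits.\<close>

lemma opow_series_commute:
  assumes "A o\<^sub>L B = B o\<^sub>L A" and S: "(\<lambda>n. a n *\<^sub>R opow A n) sums S"
  shows "S o\<^sub>L B = B o\<^sub>L S"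
proof (rule sums_unique2)
  show "(\<lambda>n. (a n *\<^sub>R opow A n) o\<^sub>L B) sums (S o\<^sub>L B)"
    by (rule bounded_linear.sums[OF bounded_linear_compose_left S])
  have "(\<lambda>n. B o\<^sub>L (a n *\<^sub>R opow A n)) sums (B o\<^sub>L S)"
    by (rule bounded_linear.sums[OF bounded_linear_compose_right S])
  then show "(\<lambda>n. (a n *\<^sub>R opow A n) o\<^sub>L B) sums (B o\<^sub>L S)"
    by (simp add: compose_bilinear_simps opow_commute[OF assms(1)])
qed

lemmas exp_op_commute = opow_series_commute[OF _ exp_op_sums]

lemma exp_op_0 [simp]: "exp_op 0 = id_blinfun"
proof (rule sums_unique2[OF exp_op_sums])
  have "(\<lambda>n. opow (0::'a \<Rightarrow>\<^sub>L 'a) n /\<^sub>R fact n) = (\<lambda>n. if n = 0 then id_blinfun else 0)"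
  proof
    show "opow (0::'a \<Rightarrow>\<^sub>L 'a) n /\<^sub>R fact n = (if n = 0 then id_blinfun else 0)" for n
      by (cases n) simp_all
  qed
  then show "(\<lambda>n. opow (0::'a \<Rightarrow>\<^sub>L 'a) n /\<^sub>R fact n) sums id_blinfun"
    using sums_single[of 0 "\<lambda>_. id_blinfun :: 'a \<Rightarrow>\<^sub>L 'a"] by simp
qed

text \<open>The n-th term is dominated by (r \<parallel>A\<parallel>)^n / n!. The uniformity is what
  termwise differentiation requires.\<close>

lemma exp_op_uniform_limit:
  fixes A :: "'a::complex_banach \<Rightarrow>\<^sub>L 'a"
  shows "uniform_limit (ball 0 r) (\<lambda>n t. \<Sum>i<n. (t ^ i / fact i) *\<^sub>R opow A i)
    (\<lambda>t. exp_op (t *\<^sub>R A)) sequentially"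
proof -
  have eq: "exp_op (t *\<^sub>R A) = (\<Sum>i. (t ^ i / fact i) *\<^sub>R opow A i)" for t
    unfolding exp_op_def opow_scaleR by (simp add: divide_inverse_commute)
  show ?thesis unfolding eq
  proof (rule Weierstrass_m_test)
    show "summable (\<lambda>n. (r * norm A) ^ n /\<^sub>R fact n)"
      by (rule summable_exp_generic)
    fix n and t :: real
    assume "t \<in> ball 0 r"
    then have "\<bar>t\<bar> \<le> r" by simp
    then have "\<bar>t\<bar> ^ n * norm (opow A n) \<le> r ^ n * norm A ^ n"
      by (intro mult_mono norm_opow power_mono) auto
    then have "\<bar>t\<bar> ^ n * norm (opow A n) / fact n \<le> r ^ n * norm A ^ n / fact n"
      by (rule divide_right_mono) simp
    then show "norm ((t ^ n / fact n) *\<^sub>R opow A n) \<le> (r * norm A) ^ n /\<^sub>R fact n"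
      by (simp add: power_abs power_mult_distrib field_simps)
  qed
qed

lemma exp_op_has_vector_derivative:
  fixes A :: "'a::complex_banach \<Rightarrow>\<^sub>L 'a"
  shows "((\<lambda>t. exp_op (t *\<^sub>R A)) has_vector_derivative (A o\<^sub>L exp_op (t *\<^sub>R A))) (at t within S)"
proof -
  define r where "r = \<bar>t\<bar> + 1"
  define f where "f n t = (t ^ n / fact n) *\<^sub>R opow A n" for n and t :: real
  \<comment> \<open>The truncated exponent \<open>n - 1\<close> at \<open>n = 0\<close> is harmless
    because of the factor \<open>real n\<close>.\<close>
  define f' where "f' n t h = (h * (real n * t ^ (n - 1) / fact n)) *\<^sub>R opow A n" for n and t h :: real
  have f_sums: "(\<lambda>n. f n t) sums exp_op (t *\<^sub>R A)" for t
    using exp_op_sums[of "t *\<^sub>R A"] unfolding opow_scaleR f_def by (simp add: divide_inverse_commute)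
  \<comment> \<open>Differentiation lowers the degree by one: \<open>Suc n\<close> derivative terms
    are \<open>A\<close> composed with \<open>n\<close> terms of the original series, so uniform
    convergence of the latter is enough.\<close>
  have f'_Suc: "(\<Sum>i<Suc n. f' i t h) = h *\<^sub>R (A o\<^sub>L (\<Sum>i<n. f i t))" for n t h
  proof -
    have "f' (Suc i) t h = h *\<^sub>R (A o\<^sub>L f i t)" for i
      by (simp add: f_def f'_def compose_bilinear_simps)
    moreover have "f' 0 t h = 0" by (simp add: f'_def)
    ultimately show ?thesis
      by (simp add: sum.lessThan_Suc_shift linear_sum[OF bounded_linear.linear[OF bounded_linear_compose_right]] scaleR_sum_right
          del: sum.lessThan_Suc)
  qed
  have "\<exists>g. \<forall>x\<in>ball 0 r. (\<lambda>n. f n x) sums g x \<and>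
      (g has_derivative (\<lambda>h. h *\<^sub>R (A o\<^sub>L exp_op (x *\<^sub>R A)))) (at x within ball 0 r)"
  proof (rule has_derivative_series[where f' = f' and x = 0])
    show "(f n has_derivative f' n x) (at x within ball 0 r)" for n x
      unfolding f_def f'_def
      by (auto intro!: derivative_eq_intros simp: fun_eq_iff)
    fix e :: real assume "e > 0"
    \<comment> \<open>Composition with \<open>A\<close> magnifies an error by at most
      \<parallel>A\<parallel>; the added 1 avoids division by zero for \<open>A = 0\<close>.\<close>
    define e' where "e' = e / (norm A + 1)"
    have e': "e' > 0" "norm A * e' \<le> e"
      using \<open>e > 0\<close> add_nonneg_pos[OF norm_ge_zero[of A] zero_less_one]
      by (simp_all add: e'_def pos_divide_le_eq distrib_left)
    have "\<forall>\<^sub>F n in sequentially. \<forall>x\<in>ball 0 r. dist (\<Sum>i<n. f i x) (exp_op (x *\<^sub>R A)) < e'"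
      using exp_op_uniform_limit[where r = r and A = A] e'(1) unfolding uniform_limit_iff f_def by blast
    then have "\<forall>\<^sub>F n in sequentially. \<forall>x\<in>ball 0 r. \<forall>h.
        norm ((\<Sum>i<Suc n. f' i x h) - h *\<^sub>R (A o\<^sub>L exp_op (x *\<^sub>R A))) \<le> e * norm h"
    proof eventually_elim
      case (elim n)
      show ?case
      proof (intro ballI allI)
        fix x h :: real
        assume x: "x \<in> ball 0 r"
        let ?d = "(\<Sum>i<n. f i x) - exp_op (x *\<^sub>R A)"
        have "norm (A o\<^sub>L ?d) \<le> norm A * norm ?d" by (rule norm_blinfun_compose)
        also have "\<dots> \<le> norm A * e'"
          using elim x by (intro mult_left_mono) (auto simp: dist_norm less_imp_le)
        finally have "norm (A o\<^sub>L ?d) \<le> e" using e'(2) by simp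
        then have "norm h * norm (A o\<^sub>L ?d) \<le> norm h * e" by (rule mult_left_mono) simp
        then show "norm ((\<Sum>i<Suc n. f' i x h) - h *\<^sub>R (A o\<^sub>L exp_op (x *\<^sub>R A))) \<le> e * norm h"
          unfolding f'_Suc by (simp add: compose_bilinear_simps scaleR_diff_right[symmetric] mult.commute)
      qed
    qed
    then show "\<forall>\<^sub>F n in sequentially. \<forall>x\<in>ball 0 r. \<forall>h.
        norm ((\<Sum>i<n. f' i x h) - h *\<^sub>R (A o\<^sub>L exp_op (x *\<^sub>R A))) \<le> e * norm h"
      by (subst eventually_sequentially_Suc[symmetric])
  qed (auto simp: r_def intro: f_sums)
  then obtain g where g: "\<And>x. x \<in> ball 0 r \<Longrightarrow> (\<lambda>n. f n x) sums g x"
    "\<And>x. x \<in> ball 0 r \<Longrightarrow>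
      (g has_derivative (\<lambda>h. h *\<^sub>R (A o\<^sub>L exp_op (x *\<^sub>R A)))) (at x within ball 0 r)"
    by blast
  have t: "t \<in> ball 0 r" by (simp add: r_def)
  have "g x = exp_op (x *\<^sub>R A)" if "x \<in> ball 0 r" for x
    using g(1)[OF that] f_sums by (rule sums_unique2)
  then have "((\<lambda>t. exp_op (t *\<^sub>R A)) has_derivative (\<lambda>h. h *\<^sub>R (A o\<^sub>L exp_op (t *\<^sub>R A)))) (at t within ball 0 r)"
    by (intro has_derivative_transform[OF t _ g(2)[OF t]]) simp
  then have "((\<lambda>t. exp_op (t *\<^sub>R A)) has_vector_derivative (A o\<^sub>L exp_op (t *\<^sub>R A))) (at t)"
    using at_within_open[OF t] by (simp add: has_vector_derivative_def)
  then show ?thesis by (rule has_vector_derivative_at_within)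
qed

lemma exp_op_commute_self: "A o\<^sub>L exp_op (t *\<^sub>R A) = exp_op (t *\<^sub>R A) o\<^sub>L A"
  by (rule exp_op_commute[symmetric]) (simp add: compose_bilinear_simps)

section \<open>Product rule and addition formula\<close>

lemma has_vector_derivative_compose_op:
  fixes f :: "real \<Rightarrow> 'b::real_normed_vector \<Rightarrow>\<^sub>L 'c::real_normed_vector"
    and g :: "real \<Rightarrow> 'a::real_normed_vector \<Rightarrow>\<^sub>L 'b"
  assumes "(f has_vector_derivative f') (at t within S)" "(g has_vector_derivative g') (at t within S)"
  shows "((\<lambda>t. f t o\<^sub>L g t) has_vector_derivative ((f t o\<^sub>L g') + (f' o\<^sub>L g t))) (at t within S)"
  by (rule bounded_bilinear.has_vector_derivative[OF bounded_bilinear_blinfun_compose assms])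

lemma exp_op_has_vector_derivative_affine:
  fixes A :: "'a::complex_banach \<Rightarrow>\<^sub>L 'a"
  shows "((\<lambda>t. exp_op ((a + b * t) *\<^sub>R A)) has_vector_derivative b *\<^sub>R (A o\<^sub>L exp_op ((a + b * t) *\<^sub>R A)))
    (at t within S)"
proof -
  have "((\<lambda>t. a + b * t) has_vector_derivative b) (at t within S)"
    by (auto intro!: derivative_eq_intros simp: has_vector_derivative_def)
  from vector_diff_chain_within[OF this exp_op_has_vector_derivative[of A]]
  show ?thesis by (simp add: o_def)
qed

lemma constant_if_vector_derivative_zero:
  fixes f :: "real \<Rightarrow> 'a::real_normed_vector"
  assumes "\<And>t. (f has_vector_derivative 0) (at t)"
  shows "f s = f t"
  using has_derivative_zero_unique[of UNIV f s t] assms by (auto simp: has_vector_derivative_def)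

text \<open>For commuting C and D the product e^(tC) e^(tD) e^(-t(C+D)) has derivative zero, hence
  keeps its value at t = 0, the identity. This avoids multiplying two series.\<close>

lemma exp_op_add_commuting:
  fixes A B :: "'a::complex_banach \<Rightarrow>\<^sub>L 'a"
  assumes AB: "A o\<^sub>L B = B o\<^sub>L A"
  shows "exp_op (A + B) = exp_op A o\<^sub>L exp_op B"
proof -
  have eq: "exp_op (t *\<^sub>R C) o\<^sub>L (exp_op (t *\<^sub>R D) o\<^sub>L exp_op ((- t) *\<^sub>R (C + D))) = id_blinfun"
    if CD: "C o\<^sub>L D = D o\<^sub>L C" for C D :: "'a \<Rightarrow>\<^sub>L 'a" and t
  proof -
    define F where "F t = exp_op (t *\<^sub>R C) o\<^sub>L (exp_op (t *\<^sub>R D) o\<^sub>L exp_op ((- t) *\<^sub>R (C + D)))" for t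
    have c1: "exp_op (t *\<^sub>R D) o\<^sub>L C = C o\<^sub>L exp_op (t *\<^sub>R D)" for t
      by (rule exp_op_commute) (simp add: compose_bilinear_simps CD)
    have c2: "exp_op (t *\<^sub>R C) o\<^sub>L D = D o\<^sub>L exp_op (t *\<^sub>R C)" for t
      by (rule exp_op_commute) (simp add: compose_bilinear_simps CD)
    have "(F has_vector_derivative 0) (at t)" for t
    proof -
      let ?C = "exp_op (t *\<^sub>R C)" and ?D = "exp_op (t *\<^sub>R D)" and ?S = "exp_op ((- t) *\<^sub>R (C + D))"
      have S: "((\<lambda>t. exp_op ((- t) *\<^sub>R (C + D))) has_vector_derivative - ((C + D) o\<^sub>L ?S)) (at t)"
        using exp_op_has_vector_derivative_affine[of 0 "-1" "C + D" t UNIV] by simp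
      have "(F has_vector_derivative
          (?C o\<^sub>L ((?D o\<^sub>L - ((C + D) o\<^sub>L ?S)) + ((D o\<^sub>L ?D) o\<^sub>L ?S))) + ((C o\<^sub>L ?C) o\<^sub>L (?D o\<^sub>L ?S))) (at t)"
        unfolding F_def
        by (intro has_vector_derivative_compose_op exp_op_has_vector_derivative S)
      also have "(?C o\<^sub>L ((?D o\<^sub>L - ((C + D) o\<^sub>L ?S)) + ((D o\<^sub>L ?D) o\<^sub>L ?S))) + ((C o\<^sub>L ?C) o\<^sub>L (?D o\<^sub>L ?S)) = 0"
      proof (rule blinfun_eqI)
        have "blinfun_apply ?D (C x) = C (?D x)" "blinfun_apply ?D (D x) = D (?D x)"
          "blinfun_apply ?C (C x) = C (?C x)" "blinfun_apply ?C (D x) = D (?C x)" for x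
          using c1 c2 exp_op_commute_self by (metis blinfun_apply_blinfun_compose)+
        then show "((?C o\<^sub>L ((?D o\<^sub>L - ((C + D) o\<^sub>L ?S)) + ((D o\<^sub>L ?D) o\<^sub>L ?S))) + ((C o\<^sub>L ?C) o\<^sub>L (?D o\<^sub>L ?S))) x
            = blinfun_apply 0 x" for x
          by (simp add: blinfun.bilinear_simps del: scaleR_minus_left)
      qed
      finally show ?thesis .
    qed
    then have "F t = F 0" by (rule constant_if_vector_derivative_zero)
    then show ?thesis by (simp add: F_def)
  qed
  let ?P = "exp_op A o\<^sub>L exp_op B" and ?N = "exp_op (- (A + B))" and ?Q = "exp_op (A + B)"
  have "?P o\<^sub>L ?N = id_blinfun"
    using eq[OF AB, of 1] by (simp add: blinfun_compose_assoc)
  \<comment> \<open>Here C = 0 and D = -(A + B). From P N = I and N Q = I follows P = P N Q =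
    Q.\<close>
  moreover have "?N o\<^sub>L ?Q = id_blinfun"
    using eq[of 0 "- (A + B)" 1] by (simp add: add.commute)
  ultimately show ?thesis
    by (metis blinfun_compose_assoc blinfun_compose_id)
qed

section \<open>Invertible complex-linear operators\<close>

lemma scaleC_diff_right: "a *\<^sub>C (x - y) = a *\<^sub>C x - a *\<^sub>C (y::'a::complex_normed_vector)"
  by (rule linear_diff[OF bounded_linear.linear[OF bounded_linear_scaleC]])

lemma scaleC_zero_left [simp]: "0 *\<^sub>C x = (0::'a::complex_normed_vector)"
  using scaleR_scaleC[of 0 x] by simp

lemma scaleC_minus_one [simp]: "(- 1) *\<^sub>C x = - (x::'a::complex_normed_vector)"
  using scaleR_scaleC[of "- 1" x] by simp

lemma scaleR_scaleC_assoc: "(r *\<^sub>R a) *\<^sub>C x = r *\<^sub>R (a *\<^sub>C (x::'a::complex_normed_vector))"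
  unfolding scaleR_conv_of_real scaleC_scaleC[symmetric] by (simp only: scaleR_scaleC)

lemma bounded_linear_scaleC_left: "bounded_linear (\<lambda>a. a *\<^sub>C (x::'a::complex_normed_vector))"
  by (rule bounded_linear_intro[where K = "norm x"])
     (simp_all add: scaleC_add_left scaleR_scaleC_assoc norm_scaleC)

lemma scaleC_diff_left: "(a - b) *\<^sub>C x = a *\<^sub>C x - b *\<^sub>C (x::'a::complex_normed_vector)"
  by (rule linear_diff[OF bounded_linear.linear[OF bounded_linear_scaleC_left]])

lemma scaleR_scaleC_commute: "r *\<^sub>R (a *\<^sub>C x) = a *\<^sub>C (r *\<^sub>R (x::'a::complex_normed_vector))"
  by (simp add: scaleR_scaleC scaleC_scaleC mult.commute)

lemma clinear_ops_apply: "A \<in> clinear_ops \<Longrightarrow> blinfun_apply A (a *\<^sub>C x) = a *\<^sub>C blinfun_apply A x"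
  by (simp add: clinear_ops_def)

text \<open>Written as a commutation relation, complex linearity passes to power series by
  \<open>opow_series_commute\<close>.\<close>

lemma clinear_ops_iff_commute: "A \<in> clinear_ops \<longleftrightarrow> (\<forall>a. A o\<^sub>L (a *\<^sub>C id_blinfun) = (a *\<^sub>C id_blinfun) o\<^sub>L A)"
  by (auto simp: clinear_ops_def scaleC_blinfun.rep_eq blinfun_apply_inject[symmetric] fun_eq_iff)

lemma clinear_ops_intros:
  "id_blinfun \<in> clinear_ops"
  "A \<in> clinear_ops \<Longrightarrow> B \<in> clinear_ops \<Longrightarrow> A o\<^sub>L B \<in> clinear_ops"
  "A \<in> clinear_ops \<Longrightarrow> B \<in> clinear_ops \<Longrightarrow> A - B \<in> clinear_ops"
  "A \<in> clinear_ops \<Longrightarrow> a *\<^sub>C A \<in> clinear_ops"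
  "A \<in> clinear_ops \<Longrightarrow> r *\<^sub>R A \<in> clinear_ops"
  by (simp_all add: clinear_ops_def blinfun.bilinear_simps scaleC_blinfun.rep_eq scaleC_diff_right
      scaleC_scaleC mult.commute scaleR_scaleC_commute)

lemma clinear_ops_opow_series:
  assumes "A \<in> clinear_ops" "(\<lambda>n. a n *\<^sub>R opow A n) sums S"
  shows "S \<in> clinear_ops"
  using opow_series_commute[OF _ assms(2)] assms(1) by (simp add: clinear_ops_iff_commute)

lemma exp_op_clinear: "A \<in> clinear_ops \<Longrightarrow> exp_op A \<in> clinear_ops"
  by (rule clinear_ops_opow_series[OF _ exp_op_sums])

lemma exp_op_scaleC_id:
  "exp_op (z *\<^sub>C id_blinfun) = exp z *\<^sub>C (id_blinfun :: 'a::complex_banach \<Rightarrow>\<^sub>L 'a)"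
proof (rule sums_unique2[OF exp_op_sums])
  let ?I = "id_blinfun :: 'a \<Rightarrow>\<^sub>L 'a"
  have "opow (z *\<^sub>C ?I) n = z ^ n *\<^sub>C ?I" for n
    by (induction n) (auto intro!: blinfun_eqI simp: scaleC_one scaleC_blinfun.rep_eq scaleC_scaleC)
  then have "opow (z *\<^sub>C ?I) n /\<^sub>R fact n = (z ^ n /\<^sub>R fact n) *\<^sub>C ?I" for n
    by (simp add: scaleR_scaleC_assoc)
  then show "(\<lambda>n. opow (z *\<^sub>C ?I) n /\<^sub>R fact n) sums (exp z *\<^sub>C ?I)"
    using bounded_linear.sums[OF bounded_linear_scaleC_left exp_converges[of z]] by simp
qed

lemma exp_op_add_scaleC_id:
  assumes "A \<in> clinear_ops"
  shows "exp_op (A + z *\<^sub>C id_blinfun) = exp z *\<^sub>C exp_op A"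
proof -
  have "A o\<^sub>L (z *\<^sub>C id_blinfun) = (z *\<^sub>C id_blinfun) o\<^sub>L A"
    using assms by (simp add: clinear_ops_iff_commute)
  moreover have "exp_op A o\<^sub>L (exp z *\<^sub>C id_blinfun) = exp z *\<^sub>C exp_op A"
    using exp_op_clinear[OF assms]
    by (auto intro!: blinfun_eqI simp: clinear_ops_apply scaleC_blinfun.rep_eq)
  ultimately show ?thesis
    by (simp add: exp_op_add_commuting exp_op_scaleC_id)
qed

lemma exp_op_scaleR_add: "exp_op ((s + t) *\<^sub>R A) = exp_op (s *\<^sub>R A) o\<^sub>L exp_op (t *\<^sub>R A)"
  by (simp add: scaleR_add_left exp_op_add_commuting compose_bilinear_simps)

section \<open>Units of L(X)\<close>

definition clinear_unit :: "('a::complex_normed_vector \<Rightarrow>\<^sub>L 'a) \<Rightarrow> bool"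
  where "clinear_unit U \<longleftrightarrow> (\<exists>V\<in>clinear_ops. V o\<^sub>L U = id_blinfun \<and> U o\<^sub>L V = id_blinfun)"

lemma spectrum_iff: "z \<in> spectrum A \<longleftrightarrow> \<not> clinear_unit (z *\<^sub>C id_blinfun - A)"
  by (simp add: spectrum_def clinear_unit_def)

text \<open>The inverse inherits complex linearity: V (a x) = V (a U V x) = V U (a V x) = a V
  x.\<close>

lemma clinear_unitI:
  assumes U: "U \<in> clinear_ops" and VU: "V o\<^sub>L U = id_blinfun" and UV: "U o\<^sub>L V = id_blinfun"
  shows "clinear_unit U"
  unfolding clinear_unit_def
proof (intro bexI conjI)
  have VU': "V (U x) = x" and UV': "U (V x) = x" for x
    using VU UV by (metis blinfun_apply_blinfun_compose blinfun_apply_id_blinfun id_apply)+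
  have "V (a *\<^sub>C x) = a *\<^sub>C V x" for a x
    using VU'[of "a *\<^sub>C V x"] by (simp add: clinear_ops_apply[OF U] UV')
  then show "V \<in> clinear_ops" by (simp add: clinear_ops_def)
  show "V o\<^sub>L U = id_blinfun" "U o\<^sub>L V = id_blinfun" by (rule VU UV)+
qed

lemma clinear_unit_compose:
  assumes "clinear_unit U" "clinear_unit V"
  shows "clinear_unit (U o\<^sub>L V)"
proof -
  obtain U' V' where *: "U' \<in> clinear_ops" "V' \<in> clinear_ops" "U' o\<^sub>L U = id_blinfun"
    "U o\<^sub>L U' = id_blinfun" "V' o\<^sub>L V = id_blinfun" "V o\<^sub>L V' = id_blinfun"
    using assms unfolding clinear_unit_def by blast
  show ?thesis unfolding clinear_unit_def
  proof (intro bexI conjI)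
    show "V' o\<^sub>L U' \<in> clinear_ops" using * by (intro clinear_ops_intros)
    show "(V' o\<^sub>L U') o\<^sub>L (U o\<^sub>L V) = id_blinfun" "(U o\<^sub>L V) o\<^sub>L (V' o\<^sub>L U') = id_blinfun"
      using * by (metis blinfun_compose_assoc blinfun_compose_id)+
  qed
qed

lemma clinear_unit_scaleC:
  assumes "clinear_unit U" "a \<noteq> 0"
  shows "clinear_unit (a *\<^sub>C U)"
proof -
  have "clinear_unit (a *\<^sub>C id_blinfun :: 'a \<Rightarrow>\<^sub>L 'a)"
    using assms(2)
    by (intro clinear_unitI[where V = "inverse a *\<^sub>C id_blinfun"] clinear_ops_intros)
       (auto intro!: blinfun_eqI simp: scaleC_blinfun.rep_eq scaleC_scaleC scaleC_one)
  moreover have "(a *\<^sub>C id_blinfun) o\<^sub>L U = a *\<^sub>C U"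
    by (auto intro!: blinfun_eqI simp: scaleC_blinfun.rep_eq)
  ultimately show ?thesis using clinear_unit_compose assms(1) by metis
qed

lemma clinear_unit_scaleR: "clinear_unit U \<Longrightarrow> r \<noteq> 0 \<Longrightarrow> clinear_unit (r *\<^sub>R U)"
  by (simp add: scaleR_scaleC clinear_unit_scaleC)

lemma exp_op_clinear_unit:
  assumes "A \<in> clinear_ops"
  shows "clinear_unit (exp_op A)"
proof (rule clinear_unitI[OF exp_op_clinear[OF assms]])
  show "exp_op (- A) o\<^sub>L exp_op A = id_blinfun" "exp_op A o\<^sub>L exp_op (- A) = id_blinfun"
    using exp_op_scaleR_add[of 1 "-1" A] exp_op_scaleR_add[of "-1" 1 A] by simp_all
qed

text \<open>With T = I - U, the sum S of the powers of T satisfies T S = S T = S - I, that is, U S =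
  S U = I.\<close>

lemma clinear_unit_Neumann:
  fixes U :: "'a::complex_banach \<Rightarrow>\<^sub>L 'a"
  assumes U: "U \<in> clinear_ops" and "norm (id_blinfun - U) < 1"
  shows "clinear_unit U"
proof -
  define T where "T = id_blinfun - U"
  have "summable (\<lambda>n. norm T ^ n)" using assms(2) by (simp add: T_def summable_geometric)
  then have "summable (\<lambda>n. opow T n)"
    by (rule summable_comparison_test') (use norm_opow[where A = T] in auto)
  then obtain S where S: "(\<lambda>n. opow T n) sums S" by (auto simp: summable_def)
  have Suc: "(\<lambda>n. opow T (Suc n)) sums (S - id_blinfun)"
    using S by (subst sums_Suc_iff) simp
  have "T o\<^sub>L S = S - id_blinfun"
  proof (rule sums_unique2)
    show "(\<lambda>n. T o\<^sub>L opow T n) sums (T o\<^sub>L S)"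
      by (rule bounded_linear.sums[OF bounded_linear_compose_right S])
    show "(\<lambda>n. T o\<^sub>L opow T n) sums (S - id_blinfun)" using Suc by simp
  qed
  moreover have "S o\<^sub>L T = T o\<^sub>L S"
    by (rule opow_series_commute[where A = T and a = "\<lambda>_. 1"]) (use S in simp_all)
  ultimately have "S o\<^sub>L (id_blinfun - T) = id_blinfun" "(id_blinfun - T) o\<^sub>L S = id_blinfun"
    by (simp_all add: compose_bilinear_simps)
  then show ?thesis
    by (intro clinear_unitI[OF U]) (simp_all add: T_def)
qed

section \<open>Invertibility of the exponential minus a scalar\<close>

text \<open>S is the power series of sinh z / z at H. By (n+3)! \<ge> 6 * 4^n and
  \<parallel>H\<parallel> \<le> 7/4, its terms after the identity are dominated by 49/96 (7/16)^n,
  whose sum is 49/54 < 1.\<close>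

lemma exp_op_minus_inverse_factor:
  fixes H :: "'a::complex_banach \<Rightarrow>\<^sub>L 'a"
  assumes H: "norm H \<le> 7 / 4"
  obtains S where "(\<lambda>n. (if even n then 1 / fact (Suc n) else 0) *\<^sub>R opow H n) sums S"
    and "norm (id_blinfun - S) < 1" and "exp_op H - exp_op (- H) = 2 *\<^sub>R (H o\<^sub>L S)"
proof -
  define a :: "nat \<Rightarrow> real" where "a n = (if even n then 1 / fact (Suc n) else 0)" for n
  have fact_ge: "6 * 4 ^ n \<le> (fact (n + 3) :: real)" for n
  proof (induction n)
    case 0
    show ?case by (simp add: fact_numeral)
  next
    case (Suc n)
    have "(6 * 4 ^ n) * 4 \<le> fact (n + 3) * (real n + 4)"
      using Suc by (intro mult_mono) auto
    moreover have "fact (Suc n + 3) = (real n + 4) * fact (n + 3)"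
      using fact_Suc[of "n + 3", where ?'a = real] by simp
    ultimately show ?case by (simp add: mult.commute)
  qed
  \<comment> \<open>Odd coefficients vanish; estimating them like the even ones lets one geometric
    series cover the tail.\<close>
  have bound: "norm (a (n + 2) *\<^sub>R opow H (n + 2)) \<le> 49 / 96 * (7 / 16) ^ n" for n
  proof -
    have "norm (opow H (n + 2)) \<le> norm H ^ (n + 2)"
      by (rule norm_opow)
    also have "\<dots> \<le> (7 / 4) ^ (n + 2)"
      using H by (rule power_mono) simp
    finally have p: "norm (opow H (n + 2)) \<le> (7 / 4) ^ (n + 2)" .
    have "\<bar>a (n + 2)\<bar> \<le> 1 / fact (n + 3)"
      by (simp add: a_def numeral_3_eq_3 numeral_2_eq_2)
    also have "\<dots> \<le> 1 / (6 * 4 ^ n)"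
      using fact_ge[of n] by (intro divide_left_mono) auto
    finally have "norm (a (n + 2) *\<^sub>R opow H (n + 2)) \<le> 1 / (6 * 4 ^ n) * (7 / 4) ^ (n + 2)"
      using p by (simp only: norm_scaleR) (intro mult_mono, auto)
    also have "\<dots> = 49 / 96 * (7 / 16) ^ n"
    proof -
      have "(7 / 16 :: real) ^ n = (7 / 4) ^ n / 4 ^ n" by (simp add: power_divide[symmetric])
      then show ?thesis by (simp add: power_add power2_eq_square)
    qed
    finally show ?thesis .
  qed
  have geo: "(\<lambda>n. 49 / 96 * (7 / 16) ^ n) sums (49 / 96 * (1 / (1 - 7 / 16)) :: real)"
    by (intro sums_mult geometric_sums) simp
  have "summable (\<lambda>n. a (n + 2) *\<^sub>R opow H (n + 2))"
    by (rule summable_comparison_test'[OF sums_summable[OF geo], of 0]) (rule bound)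
  then obtain R where R: "(\<lambda>n. a (n + 2) *\<^sub>R opow H (n + 2)) sums R"
    by (auto simp: summable_def)
  have "norm R \<le> 49 / 96 * (1 / (1 - 7 / 16))"
    using norm_suminf_le[OF bound sums_summable[OF geo]] sums_unique[OF R] sums_unique[OF geo] by simp
  then have R1: "norm R < 1" by simp
  have S: "(\<lambda>n. a n *\<^sub>R opow H n) sums (R + id_blinfun)"
  proof -
    have "(\<Sum>n<2. a n *\<^sub>R opow H n) = id_blinfun"
      by (simp add: numeral_2_eq_2 a_def)
    then show ?thesis using R sums_iff_shift[of "\<lambda>n. a n *\<^sub>R opow H n" 2 R] by simp
  qed
  have "exp_op H - exp_op (- H) = 2 *\<^sub>R (H o\<^sub>L (R + id_blinfun))"
  proof (rule sums_unique2)
    have "opow (- H) n = (- 1) ^ n *\<^sub>R opow H n" for n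
      using opow_scaleR[where t = "- 1" and A = H] by simp
    then show "(\<lambda>n. opow H n /\<^sub>R fact n - ((- 1) ^ n *\<^sub>R opow H n) /\<^sub>R fact n) sums (exp_op H - exp_op (- H))"
      using sums_diff[OF exp_op_sums[of H] exp_op_sums[of "- H"]] by simp
    have "(\<lambda>n. 2 *\<^sub>R (H o\<^sub>L (a n *\<^sub>R opow H n))) sums (2 *\<^sub>R (H o\<^sub>L (R + id_blinfun)))"
      by (intro sums_scaleR_right bounded_linear.sums[OF bounded_linear_compose_right S])
    \<comment> \<open>Term \<open>n\<close> on the left is term \<open>Suc n\<close> of e^H -
      e^(-H), whose term 0 vanishes, so the shift of index loses nothing.\<close>
    moreover have "2 *\<^sub>R (H o\<^sub>L (a n *\<^sub>R opow H n)) =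
        opow H (Suc n) /\<^sub>R fact (Suc n) - ((- 1) ^ Suc n *\<^sub>R opow H (Suc n)) /\<^sub>R fact (Suc n)" for n
      by (cases "even n") (simp_all add: a_def compose_bilinear_simps scaleR_2[symmetric] divide_inverse)
    ultimately have "(\<lambda>n. opow H (Suc n) /\<^sub>R fact (Suc n) - ((- 1) ^ Suc n *\<^sub>R opow H (Suc n)) /\<^sub>R fact (Suc n))
        sums (2 *\<^sub>R (H o\<^sub>L (R + id_blinfun)))" by simp
    then show "(\<lambda>n. opow H n /\<^sub>R fact n - ((- 1) ^ n *\<^sub>R opow H n) /\<^sub>R fact n) sums (2 *\<^sub>R (H o\<^sub>L (R + id_blinfun)))"
      by (rule sums_Suc_imp[rotated]) simp
  qed
  then show ?thesis
    using that S R1 unfolding a_def by simp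
qed

lemma exp_op_minus_id_unit_small:
  fixes B :: "'a::complex_banach \<Rightarrow>\<^sub>L 'a"
  assumes B: "B \<in> clinear_ops" and "norm B \<le> 7 / 2" and "clinear_unit B"
  shows "clinear_unit (exp_op B - id_blinfun)"
proof -
  define H where "H = (1 / 2) *\<^sub>R B"
  have H: "H \<in> clinear_ops" "norm H \<le> 7 / 4"
    using assms by (simp_all add: H_def clinear_ops_intros)
  obtain S where S: "(\<lambda>n. (if even n then 1 / fact (Suc n) else 0) *\<^sub>R opow H n) sums S"
    "norm (id_blinfun - S) < 1" "exp_op H - exp_op (- H) = 2 *\<^sub>R (H o\<^sub>L S)"
    using exp_op_minus_inverse_factor[OF H(2)] .
  have "clinear_unit S"
    using clinear_ops_opow_series[OF H(1) S(1)] S(2) by (rule clinear_unit_Neumann)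
  moreover have "clinear_unit H"
    unfolding H_def using assms(3) by (rule clinear_unit_scaleR) simp
  ultimately have "clinear_unit (exp_op H o\<^sub>L (2 *\<^sub>R (H o\<^sub>L S)))"
    by (intro clinear_unit_compose clinear_unit_scaleR exp_op_clinear_unit H(1)) simp_all
  also have "exp_op H o\<^sub>L (2 *\<^sub>R (H o\<^sub>L S)) = exp_op B - id_blinfun"
  proof -
    have "exp_op H o\<^sub>L exp_op H = exp_op B"
      using exp_op_scaleR_add[of "1/2" "1/2" B] by (simp add: H_def)
    moreover have "exp_op H o\<^sub>L exp_op (- H) = id_blinfun"
      using exp_op_scaleR_add[of 1 "-1" H] by simp
    ultimately show ?thesis
      unfolding S(3)[symmetric] by (simp add: compose_bilinear_simps)
  qed
  finally show ?thesis .
qed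

text \<open>This is x^3 - 1 = (x - 1)(x^2 + x + 1), with z and w the nontrivial cube roots of unity
  given by their sum and product. Complex linearity lets X pass the scalar w.\<close>

lemma op_cube_minus_id:
  fixes X :: "'a::complex_normed_vector \<Rightarrow>\<^sub>L 'a"
  assumes X: "X \<in> clinear_ops" and "z + w = - 1" "z * w = 1"
  shows "(X - id_blinfun) o\<^sub>L ((X - z *\<^sub>C id_blinfun) o\<^sub>L (X - w *\<^sub>C id_blinfun)) = (X o\<^sub>L (X o\<^sub>L X)) - id_blinfun"
proof -
  have "(X - z *\<^sub>C id_blinfun) o\<^sub>L (X - w *\<^sub>C id_blinfun) = (X o\<^sub>L X) + X + id_blinfun"
  proof (rule blinfun_eqI)
    fix x
    have "z *\<^sub>C X x + w *\<^sub>C X x = - X x"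
      by (simp add: scaleC_add_left[symmetric] assms(2))
    moreover have "z *\<^sub>C w *\<^sub>C x = x"
      by (simp add: scaleC_scaleC assms(3) scaleC_one)
    ultimately show "((X - z *\<^sub>C id_blinfun) o\<^sub>L (X - w *\<^sub>C id_blinfun)) x = ((X o\<^sub>L X) + X + id_blinfun) x"
      by (simp add: blinfun.bilinear_simps scaleC_blinfun.rep_eq clinear_ops_apply[OF X] scaleC_diff_right
          algebra_simps)
  qed
  then show ?thesis by (simp only:) (simp add: compose_bilinear_simps)
qed

lemma two_pi_le: "2 * pi \<le> 32 / 5"
  using pi_approx(2) by simp

text \<open>The points 2\<pi>ik are the zeros of e^z - 1. The induction variable counts, in fifths,
  how far the norm of B may exceed 7/2.\<close>

lemma exp_op_minus_id_unit:
  fixes B :: "'a::complex_banach \<Rightarrow>\<^sub>L 'a"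
  assumes "B \<in> clinear_ops"
    and "\<And>k::int. 2 * of_int k * pi * \<i> \<notin> spectrum B"
  shows "clinear_unit (exp_op B - id_blinfun)"
proof -
  obtain n :: nat where "5 * norm B \<le> real n"
    using real_arch_simple by blast
  then have "norm B \<le> 7 / 2 + real n / 5" by simp
  with assms show ?thesis
  proof (induction n arbitrary: B)
    case (0 B)
    \<comment> \<open>For k = 0 the spectral hypothesis says that B itself is invertible.\<close>
    have "clinear_unit (- 1 *\<^sub>C (0 *\<^sub>C id_blinfun - B))"
      using 0(2)[of 0] by (intro clinear_unit_scaleC) (simp_all add: spectrum_iff)
    then show ?case using 0 by (intro exp_op_minus_id_unit_small) simp_all
  next
    case (Suc n B)
    define X where "X = exp_op ((1 / 3) *\<^sub>R B)"
    \<comment> \<open>The numbers \<open>exp (w j)\<close> with \<bar>j\<bar> \<le> 1 are the three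
      cube roots of unity.\<close>
    define w where "w j = 2 * of_int j * pi * \<i> / 3" for j :: int
    have X: "X \<in> clinear_ops" by (simp add: X_def Suc.prems exp_op_clinear clinear_ops_intros)
    have unit: "clinear_unit (X - exp (w j) *\<^sub>C id_blinfun)" if j: "\<bar>j\<bar> \<le> 1" for j
    proof -
      define C where "C = (1 / 3) *\<^sub>R B - w j *\<^sub>C id_blinfun"
      have C: "C \<in> clinear_ops" by (simp add: C_def Suc.prems clinear_ops_intros)
      have nw: "cmod (w j) \<le> 32 / 15"
      proof -
        have "cmod (w j) = 2 * pi / 3 * \<bar>of_int j\<bar>" by (simp add: w_def norm_mult norm_divide)
        also have "\<dots> \<le> 2 * pi / 3 * 1" using j by (intro mult_left_mono) auto
        finally show ?thesis using two_pi_le by simp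
      qed
      have "norm C \<le> norm B / 3 + cmod (w j) * norm (id_blinfun :: 'a \<Rightarrow>\<^sub>L 'a)"
        unfolding C_def using norm_triangle_ineq4[of "(1/3) *\<^sub>R B" "w j *\<^sub>C id_blinfun"]
        by (simp add: norm_scaleC)
      also have "\<dots> \<le> norm B / 3 + 32 / 15 * 1"
        using nw norm_blinfun_id_le[where 'a = 'a] by (intro add_left_mono mult_mono) auto
      \<comment> \<open>A third of 7/2 + (n+1)/5 plus 32/15 is 33/10 + (n+1)/15, which is at most
        7/2 + n/5.\<close>
      finally have "norm C \<le> 7 / 2 + real n / 5" using Suc.prems(3) of_nat_0_le_iff[of n, where ?'a = real]
        unfolding of_nat_Suc by argo
      moreover have "2 * of_int k * pi * \<i> \<notin> spectrum C" for k :: int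
      proof -
        \<comment> \<open>The point 2\<pi>ik for C corresponds to 2\<pi>i(3k+j) for B, so C inherits
          the spectral hypothesis.\<close>
        have "clinear_unit ((1/3) *\<^sub>R ((2 * of_int (3 * k + j) * pi * \<i>) *\<^sub>C id_blinfun - B))"
          using Suc.prems(2)[of "3 * k + j"] by (intro clinear_unit_scaleR) (simp_all add: spectrum_iff)
        also have "(1/3) *\<^sub>R ((2 * of_int (3 * k + j) * pi * \<i>) *\<^sub>C id_blinfun - B) =
            (2 * of_int k * pi * \<i>) *\<^sub>C id_blinfun - C"
          by (simp add: C_def w_def scaleR_diff_right scaleR_scaleC_assoc[symmetric] scaleC_add_left[symmetric]
              scaleR_conv_of_real algebra_simps)
        finally show ?thesis by (simp add: spectrum_iff)
      qed
      ultimately have "clinear_unit (exp_op C - id_blinfun)"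
        by (intro Suc.IH C)
      then have "clinear_unit (exp (w j) *\<^sub>C (exp_op C - id_blinfun))"
        by (rule clinear_unit_scaleC) simp
      moreover have "X = exp (w j) *\<^sub>C exp_op C"
      proof -
        have "(1 / 3) *\<^sub>R B = C + w j *\<^sub>C id_blinfun" by (simp add: C_def)
        then show ?thesis unfolding X_def by (simp only: exp_op_add_scaleC_id[OF C])
      qed
      ultimately show ?thesis by (simp add: scaleC_diff_right)
    qed
    have "clinear_unit ((X - id_blinfun) o\<^sub>L ((X - exp (w 1) *\<^sub>C id_blinfun) o\<^sub>L (X - exp (w (- 1)) *\<^sub>C id_blinfun)))"
      using unit[of 0] unit[of 1] unit[of "- 1"]
      by (intro clinear_unit_compose) (simp_all add: w_def scaleC_one)
    also have "(X - id_blinfun) o\<^sub>L ((X - exp (w 1) *\<^sub>C id_blinfun) o\<^sub>L (X - exp (w (- 1)) *\<^sub>C id_blinfun))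
        = (X o\<^sub>L (X o\<^sub>L X)) - id_blinfun"
    proof (rule op_cube_minus_id[OF X])
      have "w 1 = \<i> * of_real (2 * pi / 3)" "w (- 1) = \<i> * of_real (- (2 * pi / 3))"
        by (simp_all add: w_def)
      then show "exp (w 1) + exp (w (- 1)) = - 1"
        by (simp only: cis_conv_exp[symmetric]) (simp add: complex_eq_iff cos_120)
      show "exp (w 1) * exp (w (- 1)) = 1"
        by (simp add: w_def exp_add[symmetric])
    qed
    also have "X o\<^sub>L (X o\<^sub>L X) = exp_op B"
      unfolding X_def by (simp add: exp_op_scaleR_add[symmetric])
    finally show ?case .
  qed
qed

text \<open>For B = \<omega>A - (Ln c) I one has c I - e^(\<omega>A) = -c (e^B - I). A point
  2\<pi>ik in the spectrum of B would put z = (Ln c + 2\<pi>ik) / \<omega> in the spectrum of A,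
  although e^(\<omega>z) = c.\<close>

lemma clinear_unit_diff_exp_op:
  fixes A :: "'a::complex_banach \<Rightarrow>\<^sub>L 'a"
  assumes A: "A \<in> clinear_ops" and "\<omega> \<noteq> 0" and "c \<noteq> 0"
    and c: "\<And>z. z \<in> spectrum A \<Longrightarrow> c \<noteq> exp (complex_of_real \<omega> * z)"
  shows "clinear_unit (c *\<^sub>C id_blinfun - exp_op (\<omega> *\<^sub>R A))"
proof -
  define B where "B = \<omega> *\<^sub>R A - Ln c *\<^sub>C id_blinfun"
  have B: "B \<in> clinear_ops" using A by (simp add: B_def clinear_ops_intros)
  have "2 * of_int k * pi * \<i> \<notin> spectrum B" for k :: int
  proof -
    define z where "z = (Ln c + 2 * of_int k * pi * \<i>) / complex_of_real \<omega>"
    have \<omega>z: "complex_of_real \<omega> * z = Ln c + 2 * of_int k * pi * \<i>"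
      using \<open>\<omega> \<noteq> 0\<close> by (simp add: z_def)
    have "exp (complex_of_real \<omega> * z) = c"
      unfolding \<omega>z using \<open>c \<noteq> 0\<close> exp_integer_2pi[of "of_int k"] by (simp add: exp_add mult_ac)
    then have "z \<notin> spectrum A" using c by metis
    then have "clinear_unit (\<omega> *\<^sub>R (z *\<^sub>C id_blinfun - A))"
      using \<open>\<omega> \<noteq> 0\<close> by (intro clinear_unit_scaleR) (simp_all add: spectrum_iff)
    also have "\<omega> *\<^sub>R (z *\<^sub>C id_blinfun - A) = (2 * of_int k * pi * \<i>) *\<^sub>C id_blinfun - B"
    proof -
      have "\<omega> *\<^sub>R z = Ln c + 2 * of_int k * pi * \<i>" by (simp only: scaleR_conv_of_real \<omega>z)
      then show ?thesis
        by (simp add: B_def scaleR_diff_right scaleR_scaleC_assoc[symmetric] scaleC_add_left)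
    qed
    finally show ?thesis by (simp add: spectrum_iff)
  qed
  then have "clinear_unit ((- c) *\<^sub>C (exp_op B - id_blinfun))"
    using B \<open>c \<noteq> 0\<close> by (intro clinear_unit_scaleC exp_op_minus_id_unit) simp_all
  also have "(- c) *\<^sub>C (exp_op B - id_blinfun) = c *\<^sub>C id_blinfun - exp_op (\<omega> *\<^sub>R A)"
  proof -
    have "exp_op (\<omega> *\<^sub>R A) = exp_op (B + Ln c *\<^sub>C id_blinfun)" by (simp add: B_def)
    also have "\<dots> = c *\<^sub>C exp_op B" using \<open>c \<noteq> 0\<close> by (simp add: exp_op_add_scaleC_id[OF B])
    finally have "exp_op (\<omega> *\<^sub>R A) = c *\<^sub>C exp_op B" .
    moreover have "(- c) *\<^sub>C x = - (c *\<^sub>C x)" for x :: "'a \<Rightarrow>\<^sub>L 'a"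
      using scaleC_diff_left[of 0 c x] by simp
    ultimately show ?thesis by (simp add: scaleC_diff_right)
  qed
  finally show ?thesis .
qed

lemma inverse_op_clinear_unit:
  assumes "clinear_unit U"
  shows "inverse_op U o\<^sub>L U = id_blinfun" "U o\<^sub>L inverse_op U = id_blinfun"
proof -
  obtain V where V: "V o\<^sub>L U = id_blinfun" "U o\<^sub>L V = id_blinfun"
    using assms by (auto simp: clinear_unit_def)
  have "inverse_op U = V"
    unfolding inverse_op_def
  proof (rule the_equality)
    show "W = V" if "W o\<^sub>L U = id_blinfun \<and> U o\<^sub>L W = id_blinfun" for W
      using that V by (metis blinfun_compose_assoc blinfun_compose_id)
  qed (use V in simp)
  with V show "inverse_op U o\<^sub>L U = id_blinfun" "U o\<^sub>L inverse_op U = id_blinfun" by simp_all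
qed

section \<open>The integral kernel\<close>

text \<open>For gluing at the multiples of \<omega>, where at first only the derivatives within the
  two adjacent closed periods are known.\<close>

lemma has_vector_derivative_within_Un:
  assumes "(f has_vector_derivative d) (at x within S)" "(f has_vector_derivative d) (at x within T)"
  shows "(f has_vector_derivative d) (at x within (S \<union> T))"
  using assms unfolding has_vector_derivative_def has_derivative_within
  by (auto simp: at_within_union intro: filterlim_sup)

lemma has_integral_reflect_shift:
  fixes p :: "real \<Rightarrow> 'a::real_normed_vector"
  assumes "(p has_integral I) {a..b}"
  shows "((\<lambda>s. p (k - s)) has_integral I) {k - b..k - a}"
  using has_integral_affinity[of p I a b "- 1" k] assms by simp

text \<open>The spectral hypothesis enters from here on as the invertibility of c I -
  e^(\<omega>A).\<close>

locale resolvent_kernel =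
  fixes A :: "'a::complex_banach \<Rightarrow>\<^sub>L 'a" and \<omega> :: real and c :: complex
  assumes A_clinear: "A \<in> clinear_ops" and \<omega>_pos: "\<omega> > 0"
    and unit: "clinear_unit (c *\<^sub>C id_blinfun - exp_op (\<omega> *\<^sub>R A))"
begin

section \<open>The group e^(tA) and the inverse J of c I - e^(\<omega>A)\<close>

definition E :: "real \<Rightarrow> 'a \<Rightarrow>\<^sub>L 'a" where "E t = exp_op (t *\<^sub>R A)"

definition J :: "'a \<Rightarrow>\<^sub>L 'a" where "J = inverse_op (c *\<^sub>C id_blinfun - E \<omega>)"

lemma E_scaleC: "E t (a *\<^sub>C x) = a *\<^sub>C E t x"
  unfolding E_def by (intro clinear_ops_apply exp_op_clinear clinear_ops_intros A_clinear)

lemma E_add: "E (s + t) x = E s (E t x)"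
  by (simp add: E_def exp_op_scaleR_add)

lemma E_0 [simp]: "E 0 = id_blinfun"
  by (simp add: E_def)

lemma E_commute: "E s (E t x) = E t (E s x)"
  by (simp add: E_add[symmetric] add.commute)

lemma E_cancel: "E t (E (- t) x) = x"
  using E_add[of t "- t" x] by simp

lemma scaleC_J: "c *\<^sub>C J x = x + E \<omega> (J x)"
proof -
  have "((c *\<^sub>C id_blinfun - E \<omega>) o\<^sub>L J) x = x"
    using inverse_op_clinear_unit(2)[OF unit] by (simp add: J_def E_def)
  then show ?thesis by (simp add: blinfun.bilinear_simps scaleC_blinfun.rep_eq algebra_simps)
qed

lemma J_cancel: "J (c *\<^sub>C x - E \<omega> x) = x"
proof -
  have "(J o\<^sub>L (c *\<^sub>C id_blinfun - E \<omega>)) x = x"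
    using inverse_op_clinear_unit(1)[OF unit] by (simp add: J_def E_def)
  then show ?thesis by (simp add: blinfun.bilinear_simps scaleC_blinfun.rep_eq)
qed

text \<open>Write x = c J x - e^(\<omega>A) J x. \<open>E t\<close> passes through this expression,
  and \<open>J_cancel\<close> at \<open>E t (J x)\<close> removes the outer J.\<close>

lemma J_E: "J (E t x) = E t (J x)"
proof -
  have "J (E t x) = J (E t (c *\<^sub>C J x - E \<omega> (J x)))"
    by (simp add: scaleC_J)
  also have "E t (c *\<^sub>C J x - E \<omega> (J x)) = c *\<^sub>C E t (J x) - E \<omega> (E t (J x))"
    by (simp add: blinfun.diff_right E_scaleC E_commute)
  finally show ?thesis by (simp add: J_cancel)
qed

lemma E_apply_has_vector_derivative:
  assumes "(y has_vector_derivative y') (at t within S)"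
  shows "((\<lambda>t. E t (y t)) has_vector_derivative (A (E t (y t)) + E t y')) (at t within S)"
  using bounded_bilinear.has_vector_derivative[OF bounded_bilinear_blinfun_apply
      exp_op_has_vector_derivative[of A] assms]
  by (simp add: E_def add.commute)

text \<open>The integrating factor: for y' = A y + f the derivative becomes e^(-tA) f(t).\<close>

lemma E_minus_apply_has_vector_derivative:
  assumes "(y has_vector_derivative y') (at t within S)"
  shows "((\<lambda>t. E (- t) (y t)) has_vector_derivative E (- t) (y' - A (y t))) (at t within S)"
proof -
  have "((\<lambda>t. E (- t)) has_vector_derivative - (A o\<^sub>L E (- t))) (at t within S)"
    using exp_op_has_vector_derivative_affine[of 0 "- 1" A t S] by (simp add: E_def)
  moreover have "A o\<^sub>L E (- t) = E (- t) o\<^sub>L A"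
    unfolding E_def by (rule exp_op_commute_self)
  ultimately have "((\<lambda>t. E (- t)) has_vector_derivative - (E (- t) o\<^sub>L A)) (at t within S)"
    by simp
  from bounded_bilinear.has_vector_derivative[OF bounded_bilinear_blinfun_apply this assms]
  show ?thesis
    by (simp add: blinfun.bilinear_simps)
qed

lemma continuous_on_E [continuous_intros]:
  assumes "continuous_on S f"
  shows "continuous_on S (\<lambda>t. E (f t))"
proof -
  have "continuous_on UNIV E"
    unfolding E_def[abs_def]
    by (intro continuous_at_imp_continuous_on ballI
        has_vector_derivative_continuous[OF exp_op_has_vector_derivative])
  then show ?thesis using continuous_on_compose2 assms by blast
qed

text \<open>Since c J = I + e^(\<omega>A) J, the two branches share the term e^((\<omega>+t-s)A) J
  and differ by e^((t-s)A), present only for s \<le> t. The factors depending on t stand on the left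
  and can leave the integral.\<close>

lemma kernel_apply:
  "kernel A \<omega> c t s x = E t (E \<omega> (J (E (- s) x))) + (if s \<le> t then E t (E (- s) x) else 0)"
proof -
  have "E (t - s) z = E t (E (- s) z)" "E (\<omega> + t - s) z = E t (E \<omega> (E (- s) z))" for z
    using E_add[of t "- s" z] E_add[of "\<omega> + t" "- s" z] E_add[of \<omega> t "E (- s) z"] E_commute
    by (simp_all add: algebra_simps)
  moreover have "c *\<^sub>C E t (E (- s) (J x)) = E t (E (- s) (x + E \<omega> (J x)))"
    by (simp add: E_scaleC[symmetric] scaleC_J)
  ultimately show ?thesis
    by (simp add: kernel_def E_def[symmetric] J_def[symmetric] scaleC_blinfun.rep_eq J_E blinfun.add_right
        E_commute[of "- s" \<omega>])
qed

text \<open>Variation of constants for y' = A y + f, started at the initial value that y(\<omega>) =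
  c y(0) forces. On the period it is the closed form of \<integral> K(t,s) f(s) ds.\<close>

definition periodic_response :: "(real \<Rightarrow> 'a) \<Rightarrow> real \<Rightarrow> 'a"
  where "periodic_response f t = E t (E \<omega> (J (integral {0..\<omega>} (\<lambda>s. E (- s) (f s))))
    + integral {0..t} (\<lambda>s. E (- s) (f s)))"

lemma continuous_on_E_minus_apply:
  "continuous_on S f \<Longrightarrow> continuous_on S (\<lambda>s. E (- s) (f s))"
  by (intro continuous_intros)

lemma kernel_has_integral:
  assumes f: "continuous_on {0..\<omega>} f" and t: "t \<in> {0..\<omega>}"
  shows "((\<lambda>s. kernel A \<omega> c t s (f s)) has_integral periodic_response f t) {0..\<omega>}"
proof -
  let ?q = "\<lambda>s. E (- s) (f s)"
  have q: "continuous_on {0..\<omega>} ?q" by (rule continuous_on_E_minus_apply[OF f])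
  have 1: "((\<lambda>s. E t (E \<omega> (J (?q s)))) has_integral E t (E \<omega> (J (integral {0..\<omega>} ?q)))) {0..\<omega>}"
    using has_integral_linear[OF integrable_integral[OF integrable_continuous_real[OF q]]
        blinfun.bounded_linear_right[of "E t o\<^sub>L (E \<omega> o\<^sub>L J)"]]
    by (simp add: o_def)
  have "?q integrable_on {0..t}"
    using t by (intro integrable_continuous_real continuous_on_subset[OF q]) auto
  then have "((\<lambda>s. E t (?q s)) has_integral E t (integral {0..t} ?q)) {0..t}"
    using has_integral_linear[OF integrable_integral blinfun.bounded_linear_right] by (simp add: o_def)
  then have "((\<lambda>s. if s \<in> {0..t} then E t (?q s) else 0) has_integral E t (integral {0..t} ?q)) {0..\<omega>}"
    using t by (subst has_integral_restrict) auto
  from has_integral_add[OF 1 this] show ?thesis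
    unfolding periodic_response_def blinfun.add_right
    by (rule has_integral_eq[rotated]) (simp add: kernel_apply)
qed

lemma periodic_response_has_vector_derivative:
  assumes f: "continuous_on {0..\<omega>} f" and t: "t \<in> {0..\<omega>}"
  shows "(periodic_response f has_vector_derivative (A (periodic_response f t) + f t)) (at t within {0..\<omega>})"
proof -
  let ?q = "\<lambda>s. E (- s) (f s)"
  have "((\<lambda>t. E \<omega> (J (integral {0..\<omega>} ?q)) + integral {0..t} ?q) has_vector_derivative 0 + ?q t)
      (at t within {0..\<omega>})"
    by (intro has_vector_derivative_add has_vector_derivative_const
        integral_has_vector_derivative[OF continuous_on_E_minus_apply[OF f] t])
  from E_apply_has_vector_derivative[OF this] show ?thesis
    unfolding periodic_response_def[abs_def] by (simp add: E_cancel)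
qed

lemma periodic_response_boundary: "periodic_response f \<omega> = c *\<^sub>C periodic_response f 0"
  by (simp add: periodic_response_def E_scaleC[symmetric] scaleC_J add.commute)

lemma solution_eq_periodic_response:
  assumes f: "continuous_on {0..\<omega>} f"
    and y: "\<And>t. t \<in> {0..\<omega>} \<Longrightarrow> (y has_vector_derivative (A (y t) + f t)) (at t within {0..\<omega>})"
    and "y \<omega> = c *\<^sub>C y 0" and t: "t \<in> {0..\<omega>}"
  shows "y t = periodic_response f t"
proof -
  let ?q = "\<lambda>s. E (- s) (f s)"
  have q: "integral {0..t} ?q = E (- t) (y t) - y 0" if t: "t \<in> {0..\<omega>}" for t
  proof (rule integral_unique)
    have "(?q has_integral (E (- t) (y t) - E (- 0) (y 0))) {0..t}"
    proof (rule fundamental_theorem_of_calculus)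
      fix s assume "s \<in> {0..t}"
      then have "(y has_vector_derivative (A (y s) + f s)) (at s within {0..t})"
        using t by (intro has_vector_derivative_within_subset[OF y]) auto
      from E_minus_apply_has_vector_derivative[OF this]
      show "((\<lambda>t. E (- t) (y t)) has_vector_derivative ?q s) (at s within {0..t})" by simp
    qed (use t in auto)
    then show "(?q has_integral (E (- t) (y t) - y 0)) {0..t}" by simp
  qed
  \<comment> \<open>At t = \<omega> the boundary condition leaves (c I - e^(\<omega>A)) y(0) under
    J, so the initial value in \<open>periodic_response\<close> is y(0).\<close>
  have "E \<omega> (J (integral {0..\<omega>} ?q)) = J (E \<omega> (E (- \<omega>) (y \<omega>) - y 0))"
    using q[of \<omega>] \<omega>_pos by (simp add: J_E)
  also have "E \<omega> (E (- \<omega>) (y \<omega>) - y 0) = c *\<^sub>C y 0 - E \<omega> (y 0)"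
    by (simp add: blinfun.diff_right E_cancel assms(3))
  also have "J \<dots> = y 0" by (rule J_cancel)
  finally show ?thesis
    using q[OF t] by (simp add: periodic_response_def E_cancel)
qed

text \<open>The substitutions u = t - s and u = \<omega> + t - s move t from a discontinuous
  integrand to the limits of integration of continuous functions, so continuity in t can be read
  off.\<close>

lemma kernel_norm_has_integral:
  assumes t: "t \<in> {0..\<omega>}"
  shows "((\<lambda>s. norm (kernel A \<omega> c t s)) has_integral
    (integral {0..t} (\<lambda>u. norm (c *\<^sub>C (E u o\<^sub>L J))) + integral {t..\<omega>} (\<lambda>u. norm (E u o\<^sub>L J)))) {0..\<omega>}"
proof (rule has_integral_combine)
  have c1: "continuous_on S (\<lambda>u. norm (c *\<^sub>C (E u o\<^sub>L J)))" for S
    by (intro continuous_on_norm bounded_linear.continuous_on[OF bounded_linear_scaleC]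
        bounded_linear.continuous_on[OF bounded_linear_compose_left] continuous_on_E continuous_on_id)
  have c2: "continuous_on S (\<lambda>u. norm (E u o\<^sub>L J))" for S
    by (intro continuous_on_norm
        bounded_linear.continuous_on[OF bounded_linear_compose_left] continuous_on_E continuous_on_id)
  show "((\<lambda>s. norm (kernel A \<omega> c t s)) has_integral integral {0..t} (\<lambda>u. norm (c *\<^sub>C (E u o\<^sub>L J)))) {0..t}"
  proof (rule has_integral_eq)
    show "((\<lambda>s. norm (c *\<^sub>C (E (t - s) o\<^sub>L J))) has_integral
        integral {0..t} (\<lambda>u. norm (c *\<^sub>C (E u o\<^sub>L J)))) {0..t}"
      using has_integral_reflect_shift[OF integrable_integral[OF integrable_continuous_real[OF c1]], where a = 0 and b = t and k = t]
      by simp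
  qed (simp add: kernel_def J_def E_def)
  show "((\<lambda>s. norm (kernel A \<omega> c t s)) has_integral integral {t..\<omega>} (\<lambda>u. norm (E u o\<^sub>L J))) {t..\<omega>}"
  \<comment> \<open>At s = t the kernel takes its first branch, hence the exceptional point.\<close>
  proof (rule has_integral_spike_finite[of "{t}"])
    show "((\<lambda>s. norm (E (\<omega> + t - s) o\<^sub>L J)) has_integral integral {t..\<omega>} (\<lambda>u. norm (E u o\<^sub>L J))) {t..\<omega>}"
      using has_integral_reflect_shift[OF integrable_integral[OF integrable_continuous_real[OF c2]], where a = t and b = \<omega> and k = "\<omega> + t"]
      by simp
  qed (auto simp: kernel_def J_def E_def)
qed (use t in auto)

text \<open>Continuity in t ensures that the maximum behind \<open>kernel_max\<close> is
  attained.\<close>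

lemma kernel_integral_le_max:
  assumes "t \<in> {0..\<omega>}"
  shows "integral {0..\<omega>} (\<lambda>s. norm (kernel A \<omega> c t s)) \<le> kernel_max A \<omega> c"
  unfolding kernel_max_def
proof (rule max_on_continuous(2)[OF compact_Icc _ _ assms])
  have "continuous_on {0..\<omega>} (\<lambda>t. integral {0..t} (\<lambda>u. norm (c *\<^sub>C (E u o\<^sub>L J)))
      + integral {t..\<omega>} (\<lambda>u. norm (E u o\<^sub>L J)))"
    by (intro continuous_on_add indefinite_integral_continuous_1 indefinite_integral_continuous_1'
        integrable_continuous_real continuous_on_norm bounded_linear.continuous_on[OF bounded_linear_scaleC]
        bounded_linear.continuous_on[OF bounded_linear_compose_left] continuous_on_E continuous_on_id)
  then show "continuous_on {0..\<omega>} (\<lambda>t. integral {0..\<omega>} (\<lambda>s. norm (kernel A \<omega> c t s)))"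
    by (rule continuous_on_eq) (rule integral_unique[OF kernel_norm_has_integral, symmetric])
qed (use \<omega>_pos in simp)

lemma kernel_max_nonneg: "kernel_max A \<omega> c \<ge> 0"
proof -
  have "0 \<le> integral {0..\<omega>} (\<lambda>s. norm (kernel A \<omega> c 0 s))"
    using \<omega>_pos by (intro integral_nonneg has_integral_integrable[OF kernel_norm_has_integral]) auto
  also have "\<dots> \<le> kernel_max A \<omega> c" using \<omega>_pos by (intro kernel_integral_le_max) simp
  finally show ?thesis .
qed

section \<open>Bound and linearity of the integral operator\<close>

lemma norm_periodic_response_le:
  assumes f: "continuous_on {0..\<omega>} f" and C: "\<And>s. s \<in> {0..\<omega>} \<Longrightarrow> norm (f s) \<le> C"
    and t: "t \<in> {0..\<omega>}"
  shows "norm (periodic_response f t) \<le> kernel_max A \<omega> c * C"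
proof -
  have "0 \<le> norm (f t)" by simp
  also have "\<dots> \<le> C" using C t .
  finally have "C \<ge> 0" .
  note K = kernel_has_integral[OF f t]
  have N: "(\<lambda>s. norm (kernel A \<omega> c t s)) integrable_on {0..\<omega>}"
    by (rule has_integral_integrable[OF kernel_norm_has_integral[OF t]])
  have "norm (integral {0..\<omega>} (\<lambda>s. kernel A \<omega> c t s (f s)))
      \<le> integral {0..\<omega>} (\<lambda>s. norm (kernel A \<omega> c t s) * C)"
  proof (rule integral_norm_bound_integral[OF has_integral_integrable[OF K]])
    show "(\<lambda>s. norm (kernel A \<omega> c t s) * C) integrable_on {0..\<omega>}"
      by (rule integrable_on_mult_left[OF N])
    fix s assume "s \<in> {0..\<omega>}"
    have "norm (kernel A \<omega> c t s (f s)) \<le> norm (kernel A \<omega> c t s) * norm (f s)" by (rule norm_blinfun)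
    also have "\<dots> \<le> norm (kernel A \<omega> c t s) * C" by (intro mult_left_mono C \<open>s \<in> {0..\<omega>}\<close>) simp
    finally show "norm (kernel A \<omega> c t s (f s)) \<le> norm (kernel A \<omega> c t s) * C" .
  qed
  also have "\<dots> = integral {0..\<omega>} (\<lambda>s. norm (kernel A \<omega> c t s)) * C" by simp
  also have "\<dots> \<le> kernel_max A \<omega> c * C"
    using kernel_integral_le_max[OF t] \<open>C \<ge> 0\<close> by (rule mult_right_mono)
  finally show ?thesis using integral_unique[OF K] by simp
qed

lemma periodic_response_diff:
  assumes "continuous_on {0..\<omega>} f" "continuous_on {0..\<omega>} h" "t \<in> {0..\<omega>}"
  shows "periodic_response f t - periodic_response h t = periodic_response (\<lambda>s. f s - h s) t"
proof (rule has_integral_unique)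
  show "((\<lambda>s. kernel A \<omega> c t s (f s - h s)) has_integral periodic_response f t - periodic_response h t) {0..\<omega>}"
    using has_integral_diff[OF kernel_has_integral[OF assms(1,3)] kernel_has_integral[OF assms(2,3)]]
    by (simp add: blinfun.diff_right)
  show "((\<lambda>s. kernel A \<omega> c t s (f s - h s)) has_integral periodic_response (\<lambda>s. f s - h s) t) {0..\<omega>}"
    by (intro kernel_has_integral continuous_on_diff assms)
qed

end

section \<open>Periodic solutions\<close>

text \<open>Each application of the hypothesis shifts n by one; going down, the common factor c is
  cancelled.\<close>

lemma quasi_periodic_power_int:
  fixes g :: "real \<Rightarrow> 'a::complex_banach \<Rightarrow> 'a"
  assumes g: "\<And>t x. g (t + \<omega>) (c *\<^sub>C x) = c *\<^sub>C g t x" and "c \<noteq> 0"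
  shows "g (t + of_int n * \<omega>) (c powi n *\<^sub>C x) = c powi n *\<^sub>C g t x"
proof (induction n rule: int_induct[where k = 0])
  case base
  show ?case by (simp add: scaleC_one)
next
  case (step1 i)
  then show ?case
    using g[of "t + of_int i * \<omega>" "c powi i *\<^sub>C x"] \<open>c \<noteq> 0\<close>
    by (simp add: power_int_add scaleC_scaleC algebra_simps)
next
  case (step2 i)
  let ?r = "g (t + of_int (i - 1) * \<omega>) (c powi (i - 1) *\<^sub>C x)"
  have ci: "c powi i = c * c powi (i - 1)"
    using \<open>c \<noteq> 0\<close> power_int_add[of c "i - 1" 1] by simp
  have "c *\<^sub>C ?r = c *\<^sub>C (c powi (i - 1) *\<^sub>C g t x)"
    using step2 g[of "t + of_int (i - 1) * \<omega>" "c powi (i - 1) *\<^sub>C x"]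
    by (simp add: ci scaleC_scaleC algebra_simps)
  then have "inverse c *\<^sub>C c *\<^sub>C ?r = inverse c *\<^sub>C c *\<^sub>C (c powi (i - 1) *\<^sub>C g t x)" by simp
  then show ?case using \<open>c \<noteq> 0\<close> by (simp add: scaleC_scaleC scaleC_one mult.assoc[symmetric])
qed

text \<open>The translates c^n y(t - n\<omega>) are pasted together. They agree at common endpoints
  because y(\<omega>) = c y(0), and the one-sided derivatives agree there too, both being given by
  the equation.\<close>

lemma wc_periodic_extension:
  fixes A :: "'a::complex_banach \<Rightarrow>\<^sub>L 'a" and g :: "real \<Rightarrow> 'a \<Rightarrow> 'a"
  assumes A: "A \<in> clinear_ops" and "\<omega> > 0" and "c \<noteq> 0"
    and g: "\<And>t x. g (t + \<omega>) (c *\<^sub>C x) = c *\<^sub>C g t x"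
    and y: "\<And>t. t \<in> {0..\<omega>} \<Longrightarrow> (y has_vector_derivative (A (y t) + g t (y t))) (at t within {0..\<omega>})"
    and y\<omega>: "y \<omega> = c *\<^sub>C y 0"
  shows "\<exists>Y. wc_periodic \<omega> c Y \<and> ode_solution A g Y"
proof -
  define Y where "Y t = c powi \<lfloor>t / \<omega>\<rfloor> *\<^sub>C y (t - of_int \<lfloor>t / \<omega>\<rfloor> * \<omega>)" for t
  define I where "I n = {of_int n * \<omega>..of_int n * \<omega> + \<omega>}" for n :: int
  have Y_I: "Y t = c powi n *\<^sub>C y (t - of_int n * \<omega>)" if t: "t \<in> I n" for t n
  \<comment> \<open>At the right endpoint of \<open>I n\<close> the floor is already n + 1, so Y
    uses y(0) there and the boundary condition restores y(\<omega>).\<close>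
  proof (cases "t = of_int n * \<omega> + \<omega>")
    case True
    then have "t / \<omega> = of_int (n + 1)" using \<open>\<omega> > 0\<close> by (simp add: field_simps)
    then have fl: "\<lfloor>t / \<omega>\<rfloor> = n + 1" by (simp only: floor_of_int)
    have "t - of_int (n + 1) * \<omega> = 0" "t - of_int n * \<omega> = \<omega>"
      using True by (simp_all add: algebra_simps)
    then show ?thesis unfolding Y_def fl
      using \<open>c \<noteq> 0\<close> by (simp add: y\<omega> scaleC_scaleC power_int_add)
  next
    case False
    then have "\<lfloor>t / \<omega>\<rfloor> = n"
      using t \<open>\<omega> > 0\<close> by (intro floor_unique) (auto simp: I_def field_simps)
    then show ?thesis by (simp add: Y_def)
  qed
  have deriv: "(Y has_vector_derivative (A (Y t) + g t (Y t))) (at t within I n)" if t: "t \<in> I n" for t n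
  proof -
    let ?s = "t - of_int n * \<omega>"
    have "(\<lambda>t. t - of_int n * \<omega>) ` I n \<subseteq> {0..\<omega>}" by (auto simp: I_def)
    moreover have "?s \<in> {0..\<omega>}" using t by (auto simp: I_def)
    ultimately have y': "(y has_vector_derivative (A (y ?s) + g ?s (y ?s))) (at ?s within (\<lambda>t. t - of_int n * \<omega>) ` I n)"
      by (intro has_vector_derivative_within_subset[OF y])
    have "((\<lambda>t. t - of_int n * \<omega>) has_vector_derivative 1) (at t within I n)"
      by (auto intro!: derivative_eq_intros simp: has_vector_derivative_def)
    from bounded_linear.has_vector_derivative[OF bounded_linear_scaleC vector_diff_chain_within[OF this y']]
    have "((\<lambda>t. c powi n *\<^sub>C y (t - of_int n * \<omega>)) has_vector_derivative
        c powi n *\<^sub>C (A (y ?s) + g ?s (y ?s))) (at t within I n)"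
      by (simp add: o_def)
    \<comment> \<open>The iterated periodicity of g and the complex linearity of A carry the
      equation from the first period to \<open>I n\<close>.\<close>
    moreover have "c powi n *\<^sub>C (A (y ?s) + g ?s (y ?s)) = A (Y t) + g t (Y t)"
      using quasi_periodic_power_int[where g = g, OF g \<open>c \<noteq> 0\<close>, of ?s n "y ?s"]
      by (simp add: Y_I[OF t] scaleC_add_right clinear_ops_apply[OF A])
    ultimately show ?thesis
      using has_vector_derivative_transform[OF t Y_I] by simp
  qed
  have "(Y has_vector_derivative (A (Y t) + g t (Y t))) (at t)" for t
  proof -
    define n where "n = \<lfloor>t / \<omega>\<rfloor>"
    have "of_int n \<le> t / \<omega>" "t / \<omega> < of_int n + 1" unfolding n_def by linarith+
    then have n: "of_int n * \<omega> \<le> t" "t < of_int n * \<omega> + \<omega>"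
      using \<open>\<omega> > 0\<close> by (simp_all add: pos_le_divide_eq pos_divide_less_eq distrib_right)
    then have tI: "t \<in> I n" by (auto simp: I_def)
    show ?thesis
    proof (cases "t = of_int n * \<omega>")
      case False
      then have "t \<in> interior (I n)" using n by (simp add: I_def)
      then show ?thesis using deriv[OF tI] at_within_interior by metis
    next
      case True
      have tI': "t \<in> I (n - 1)" using True \<open>\<omega> > 0\<close> by (simp add: I_def algebra_simps)
      have "I (n - 1) \<union> I n = {of_int n * \<omega> - \<omega>..of_int n * \<omega> + \<omega>}"
        using \<open>\<omega> > 0\<close> by (auto simp: I_def algebra_simps)
      then have "t \<in> interior (I (n - 1) \<union> I n)" using True \<open>\<omega> > 0\<close> by simp
      then show ?thesis
        using has_vector_derivative_within_Un[OF deriv[OF tI'] deriv[OF tI]] at_within_interior by metis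
    qed
  qed
  then have "ode_solution A g Y" by (simp add: ode_solution_def)
  moreover have "wc_periodic \<omega> c Y"
    unfolding wc_periodic_def
  proof
    fix t
    have "(t + \<omega>) / \<omega> = t / \<omega> + 1" using \<open>\<omega> > 0\<close> by (simp add: field_simps)
    then have "\<lfloor>(t + \<omega>) / \<omega>\<rfloor> = \<lfloor>t / \<omega>\<rfloor> + 1" by simp
    then show "Y (t + \<omega>) = c *\<^sub>C Y t"
      using \<open>c \<noteq> 0\<close> by (simp add: Y_def power_int_add scaleC_scaleC algebra_simps)
  qed
  ultimately show ?thesis by blast
qed

lemma wc_periodic_eqI:
  assumes y: "wc_periodic \<omega> c y" and z: "wc_periodic \<omega> c z" and "\<omega> > 0" and "c \<noteq> 0"
    and eq: "\<And>t. t \<in> {0..\<omega>} \<Longrightarrow> y t = z t"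
  shows "y = z"
proof
  fix t
  \<comment> \<open>A function of t alone is treated as a g that ignores its second
    argument.\<close>
  have per: "w (t + of_int n * \<omega>) = c powi n *\<^sub>C w t" if "wc_periodic \<omega> c w" for w n t
    using quasi_periodic_power_int[of "\<lambda>t _. w t" \<omega> c t n 0] that \<open>c \<noteq> 0\<close> by (simp add: wc_periodic_def)
  define n where "n = \<lfloor>t / \<omega>\<rfloor>"
  have "of_int n \<le> t / \<omega>" "t / \<omega> < of_int n + 1" unfolding n_def by linarith+
  then have n: "t - of_int n * \<omega> \<in> {0..\<omega>}"
    using \<open>\<omega> > 0\<close> by (simp add: pos_le_divide_eq pos_divide_less_eq distrib_right)
  show "y t = z t"
    using per[OF y, of "t - of_int n * \<omega>" n] per[OF z, of "t - of_int n * \<omega>" n] eq[OF n] by simp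
qed

lemma norm0_continuous:
  assumes "\<omega> > 0" "continuous_on {0..\<omega>} h"
  shows "norm0 \<omega> h \<in> (\<lambda>t. norm (h t)) ` {0..\<omega>}"
    and "t \<in> {0..\<omega>} \<Longrightarrow> norm (h t) \<le> norm0 \<omega> h"
proof -
  have c: "continuous_on {0..\<omega>} (\<lambda>t. norm (h t))" by (rule continuous_on_norm[OF assms(2)])
  have ne: "{0..\<omega>} \<noteq> {}" using assms(1) by simp
  show "norm0 \<omega> h \<in> (\<lambda>t. norm (h t)) ` {0..\<omega>}"
    unfolding norm0_def by (rule max_on_continuous(1)[OF compact_Icc ne c])
  show "norm (h t) \<le> norm0 \<omega> h" if "t \<in> {0..\<omega>}"
    unfolding norm0_def using max_on_continuous(2)[OF compact_Icc ne c that] .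
qed

theorem theorem3p1:
  fixes A :: "'a::complex_banach \<Rightarrow>\<^sub>L 'a"
    and \<omega> L :: real
    and c :: complex
    and g :: "real \<Rightarrow> 'a \<Rightarrow> 'a"
  assumes "A \<in> clinear_ops"
    and "\<omega> > 0"
    and "c \<noteq> 0"
    and "\<And>z. z \<in> spectrum A \<Longrightarrow> c \<noteq> exp (complex_of_real \<omega> * z)"
    and "continuous_on UNIV (\<lambda>(t, x). g t x)"
    and "\<And>t x. g (t + \<omega>) (c *\<^sub>C x) = c *\<^sub>C g t x"
    and "L > 0"
    and "\<And>t x\<^sub>1 x\<^sub>2. norm (g t x\<^sub>1 - g t x\<^sub>2) \<le> L * norm (x\<^sub>1 - x\<^sub>2)"
    and "L * kernel_max A \<omega> c < 1"
  shows "(\<exists>!y. wc_periodic \<omega> c y \<and> ode_solution A g y) \<and>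
    (\<forall>y. wc_periodic \<omega> c y \<and> ode_solution A g y \<longrightarrow>
      norm0 \<omega> y \<le> kernel_max A \<omega> c * norm0 \<omega> (\<lambda>t. g t 0) / (1 - L * kernel_max A \<omega> c))"
proof -
  interpret resolvent_kernel A \<omega> c
    using assms(1-4) by unfold_locales (auto intro: clinear_unit_diff_exp_op)
  let ?M = "kernel_max A \<omega> c"
  have M0: "?M \<ge> 0" by (rule kernel_max_nonneg)
  have cont_g: "continuous_on S (\<lambda>t. g t (u t))" if "continuous_on S u" for S u
    using continuous_on_compose2[OF assms(5) continuous_on_Pair[OF continuous_on_id that]] by simp
  \<comment> \<open>The nonlinear integral operator has Lipschitz constant L M; only the distance of
    u and v on one period enters.\<close>
  have response_dist:
    "norm (periodic_response (\<lambda>s. g s (u s)) t - periodic_response (\<lambda>s. g s (v s)) t) \<le> L * ?M * d"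
    if "continuous_on {0..\<omega>} u" "continuous_on {0..\<omega>} v" "t \<in> {0..\<omega>}"
      and d: "\<And>s. s \<in> {0..\<omega>} \<Longrightarrow> norm (u s - v s) \<le> d" for u v t d
  proof -
    have "norm (periodic_response (\<lambda>s. g s (u s) - g s (v s)) t) \<le> ?M * (L * d)"
    proof (rule norm_periodic_response_le)
      fix s assume "s \<in> {0..\<omega>}"
      have "norm (g s (u s) - g s (v s)) \<le> L * norm (u s - v s)" by (rule assms(8))
      also have "\<dots> \<le> L * d" using d \<open>s \<in> {0..\<omega>}\<close> \<open>L > 0\<close> by simp
      finally show "norm (g s (u s) - g s (v s)) \<le> L * d" .
    qed (use that in \<open>auto intro: continuous_on_diff cont_g\<close>)
    then show ?thesis using that by (simp add: periodic_response_diff cont_g mult_ac)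
  qed
  \<comment> \<open>Every periodic solution solves the integral equation on a period; uniqueness and
    the bound both start from this.\<close>
  have rep: "continuous_on {0..\<omega>} y \<and>
      (\<forall>t\<in>{0..\<omega>}. y t = periodic_response (\<lambda>s. g s (y s)) t)"
    if "wc_periodic \<omega> c y" "ode_solution A g y" for y
  proof -
    have d: "(y has_vector_derivative (A (y t) + g t (y t))) (at t within S)" for t S
      using that(2) by (simp add: ode_solution_def has_vector_derivative_at_within)
    have y: "continuous_on {0..\<omega>} y"
      by (rule continuous_on_vector_derivative[OF d])
    moreover have "y \<omega> = c *\<^sub>C y 0"
      using that(1) by (metis wc_periodic_def add_0)
    ultimately show ?thesis
      using solution_eq_periodic_response[OF cont_g[OF y] d] by blast
  qed
  \<comment> \<open>Bounded continuous functions on the line serve as the complete metric space;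
    \<open>clamp\<close> extends the image constantly on either side of the period.\<close>
  have "\<exists>v::real \<Rightarrow>\<^sub>C 'a. \<forall>t. v t = periodic_response (\<lambda>s. g s (u s)) (clamp 0 \<omega> t)" for u :: "real \<Rightarrow>\<^sub>C 'a"
  proof -
    have "continuous_on {0..\<omega>} (periodic_response (\<lambda>s. g s (u s)))"
      by (rule continuous_on_vector_derivative[OF periodic_response_has_vector_derivative])
         (auto intro: cont_g)
    then show ?thesis
      using continuous_on_cbox_bcontfunE[of 0 \<omega> "periodic_response (\<lambda>s. g s (u s))"]
      by (metis cbox_interval)
  qed
  then obtain \<Phi> :: "(real \<Rightarrow>\<^sub>C 'a) \<Rightarrow> (real \<Rightarrow>\<^sub>C 'a)"
    where \<Phi>: "\<And>u t. \<Phi> u t = periodic_response (\<lambda>s. g s (u s)) (clamp 0 \<omega> t)"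
    by metis
  have "\<exists>!u. \<Phi> u = u"
  proof (rule banach_fix_type)
    show "\<forall>u v. dist (\<Phi> u) (\<Phi> v) \<le> L * ?M * dist u v"
    proof (intro allI dist_bound)
      fix u v :: "real \<Rightarrow>\<^sub>C 'a" and t
      have "clamp 0 \<omega> t \<in> {0..\<omega>}"
        using clamp_in_interval[of 0 \<omega> t] \<open>\<omega> > 0\<close> by simp
      then show "dist (\<Phi> u t) (\<Phi> v t) \<le> L * ?M * dist u v"
        unfolding \<Phi> dist_norm[of "periodic_response _ _"]
        by (intro response_dist) (auto simp: dist_norm[symmetric] dist_bounded)
    qed
  qed (use assms(9) M0 \<open>L > 0\<close> in auto)
  then obtain u where "\<Phi> u = u" by blast
  then have u: "u t = periodic_response (\<lambda>s. g s (u s)) t" if "t \<in> {0..\<omega>}" for t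
    using \<Phi>[of u t] that by simp
  \<comment> \<open>By clamping, \<open>u\<close> is constant on either side of the period.
    \<open>?y\<close> agrees with it on the period and carries the derivative and boundary condition
    needed for the periodic extension.\<close>
  let ?y = "periodic_response (\<lambda>s. g s (u s))"
  have ex: "\<exists>y. wc_periodic \<omega> c y \<and> ode_solution A g y"
  proof (rule wc_periodic_extension[where g = g, OF assms(1-3,6)])
    show "?y \<omega> = c *\<^sub>C ?y 0" by (rule periodic_response_boundary)
    fix t assume t: "t \<in> {0..\<omega>}"
    show "(?y has_vector_derivative A (?y t) + g t (?y t)) (at t within {0..\<omega>})"
      using periodic_response_has_vector_derivative[OF cont_g t, of u] u[OF t] by simp
  qed
  have unique: "y = z"
    if y: "wc_periodic \<omega> c y" "ode_solution A g y" and z: "wc_periodic \<omega> c z" "ode_solution A g z" for y z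
  proof (rule wc_periodic_eqI[OF y(1) z(1) \<open>\<omega> > 0\<close> \<open>c \<noteq> 0\<close>])
    let ?d = "norm0 \<omega> (\<lambda>t. y t - z t)"
    have c: "continuous_on {0..\<omega>} (\<lambda>t. y t - z t)" using rep y z by (intro continuous_on_diff) auto
    note nd = norm0_continuous[OF \<open>\<omega> > 0\<close> c]
    have "norm (y t - z t) \<le> L * ?M * ?d" if "t \<in> {0..\<omega>}" for t
      using response_dist[OF _ _ that nd(2)] rep[OF y] rep[OF z] that by simp
    \<comment> \<open>The maximum is attained, so the pointwise estimate holds for it; L M < 1 then
      forces it to vanish.\<close>
    then have "?d \<le> L * ?M * ?d" using nd(1) by auto
    then have "?d * (1 - L * ?M) \<le> 0" by (simp add: algebra_simps)
    then have "?d \<le> 0" using assms(9) by (simp add: mult_le_0_iff)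
    then have "norm (y t - z t) \<le> 0" if "t \<in> {0..\<omega>}" for t
      using nd(2)[OF that] by (rule order_trans[rotated])
    then show "y t = z t" if "t \<in> {0..\<omega>}" for t using that by simp
  qed
  have bound: "norm0 \<omega> y \<le> ?M * norm0 \<omega> (\<lambda>t. g t 0) / (1 - L * ?M)"
    if y: "wc_periodic \<omega> c y" "ode_solution A g y" for y
  proof -
    have c: "continuous_on {0..\<omega>} y" using rep[OF y] by simp
    note ny = norm0_continuous[OF \<open>\<omega> > 0\<close> c]
    note ng = norm0_continuous[OF \<open>\<omega> > 0\<close> cont_g[OF continuous_on_const, of _ 0]]
    \<comment> \<open>Comparison with g(s,0) bounds g(s, y s) on the period by L
      \<parallel>y\<parallel> plus the norm of g(.,0).\<close>
    have "norm (y t) \<le> ?M * (L * norm0 \<omega> y + norm0 \<omega> (\<lambda>t. g t 0))" if t: "t \<in> {0..\<omega>}" for t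
    proof -
      have "norm (periodic_response (\<lambda>s. g s (y s)) t) \<le> ?M * (L * norm0 \<omega> y + norm0 \<omega> (\<lambda>t. g t 0))"
      proof (rule norm_periodic_response_le[OF cont_g[OF c] _ t])
        fix s assume s: "s \<in> {0..\<omega>}"
        have "norm (g s (y s)) \<le> norm (g s (y s) - g s 0) + norm (g s 0)"
          using norm_triangle_ineq[of "g s (y s) - g s 0" "g s 0"] by simp
        also have "norm (g s (y s) - g s 0) \<le> L * norm (y s)" using assms(8)[of s "y s" 0] by simp
        also have "\<dots> \<le> L * norm0 \<omega> y" using ny(2)[OF s] \<open>L > 0\<close> by simp
        also have "norm (g s 0) \<le> norm0 \<omega> (\<lambda>t. g t 0)" by (rule ng(2)[OF s])
        finally show "norm (g s (y s)) \<le> L * norm0 \<omega> y + norm0 \<omega> (\<lambda>t. g t 0)" by simp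
      qed
      then show ?thesis using rep[OF y] t by simp
    qed
    \<comment> \<open>Again the maximum is attained, and 1 - L M > 0 permits solving for
      \<open>norm0 \<omega> y\<close>.\<close>
    then have "norm0 \<omega> y \<le> ?M * (L * norm0 \<omega> y + norm0 \<omega> (\<lambda>t. g t 0))" using ny(1) by auto
    then show ?thesis using assms(9) by (simp add: field_simps)
  qed
  show ?thesis using ex unique bound by blast
qed

end
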